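(* For $q\in\mathbb{C}$ with $|q|<1$, $$\sum_{i,j\geq 0} \frac{q^{2i^2-ij+\frac{1}{2}j^2-\frac{1}{2}j}}{(q;q)_{2i}(q;q)_{j}}=\frac{2}{(q;q^2)_{\infty}^2(q^{2},q^{8};q^{10})_{\infty}},\qquad \sum_{i,j\geq 0} \frac{q^{2i^2-ij+\frac{1}{2}j^2+i-\frac{1}{2}j}}{(q;q)_{2i+1}(q;q)_{j}}=\frac{2}{(q;q^2)_{\infty}^2(q^{2},q^{8};q^{10})_{\infty}},$$ $$\sum_{i,j\geq 0} \frac{q^{2i^2-ij+\frac{1}{2}j^2+2i-\frac{1}{2}j}}{(q;q)_{2i+1}(q;q)_{j}}=\frac{2}{(q;q^2)_{\infty}^2(q^{4},q^{6};q^{10})_{\infty}},$$ $$\sum_{i,j\geq 0} \frac{q^{4i^2-2ij+j^2-2i}}{(q^2;q^2)_{2i}(q^2;q^2)_{j}}=\frac{J_{2}^2J_{10}J_{3,10}J_{2,20}J_{6,20}}{J_{1}^2J_{20}^3J_{8,20}},\qquad \sum_{i,j\geq 0} \frac{q^{4i^2-2ij+j^2}}{(q^2;q^2)_{2i}(q^2;q^2)_{j}}=\frac{J_{2}^2J_{10}J_{1,10}J_{2,20}J_{6,20}}{J_{1}^2J_{20}^3J_{4,20}}.$$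
   Context: For $|q|<1$: $(a;q)_\infty=\prod_{k\ge0}(1-aq^k)$; for integers $n\ge0$, $(a;q)_n=\prod_{k=0}^{n-1}(1-aq^k)$; $(a_1,\dots,a_m;q)_\infty=\prod_{k=1}^m(a_k;q)_\infty$; $J_m:=(q^m;q^m)_\infty$ and $J_{a,m}:=(q^a,q^{m-a},q^m;q^m)_\infty$. All exponents of $q$ appearing in the sums are integers. *)

theory Defs
  imports "HOL-Analysis.Analysis"
begin

definition qpoch :: "complex \<Rightarrow> complex \<Rightarrow> nat \<Rightarrow> complex" where
  "qpoch a q n = (\<Prod>k<n. 1 - a * q ^ k)"

(* Meaningful for norm q < 1, where the product converges for every a (possibly to 0). *)
definition qpoch_inf :: "complex \<Rightarrow> complex \<Rightarrow> complex" where
  "qpoch_inf a q = (\<Prod>k. 1 - a * q ^ k)"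

(* (a_1, ..., a_m; q)_infinity *)
definition qpochs_inf :: "complex list \<Rightarrow> complex \<Rightarrow> complex" where
  "qpochs_inf as q = (\<Prod>a\<leftarrow>as. qpoch_inf a q)"

(* J_m and J_{a,m}; the base q is implicit in the usual notation and is the last argument here.
   In J_{a,m} the difference m - a is a natural-number one, so a \<le> m is intended. *)
definition Jm :: "nat \<Rightarrow> complex \<Rightarrow> complex" where
  "Jm m q = qpoch_inf (q ^ m) (q ^ m)"

definition Jam :: "nat \<Rightarrow> nat \<Rightarrow> complex \<Rightarrow> complex" where
  "Jam a m q = qpochs_inf [q ^ a, q ^ (m - a), q ^ m] (q ^ m)"

end

theory Submission
  imports Defs
begin

text \<open>
  Summing over \<open>j\<close> with Euler's identity
  \<open>\<Sum>\<^sub>j q\<^bsup>j(j-1)/2\<^esup> x\<^sup>j / (q;q)\<^sub>j = (-x;q)\<^sub>\<infinity>\<close> turns each double sum into an infinite product times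
  one of the single Rogers--Slater sums with denominators \<open>(q;q)\<^sub>i (q;q\<^sup>2)\<^sub>i\<close>, \<open>(q;q)\<^sub>i (q;q\<^sup>2)\<^sub>i\<^sub>+\<^sub>1\<close>
  (three cases) or \<open>(q;q\<^sup>2)\<^sub>i (q\<^sup>4;q\<^sup>4)\<^sub>i\<close> (two cases). These come from Bailey's lemma: the summand is
  \<open>q\<^bsup>n\<^sup>2+En\<^esup>\<close> (\<open>E = 0, 1\<close>) times a finite sum \<open>\<Sum>\<^sub>m w\<^sub>m / ((q;q)\<^sub>m (q;q)\<^bsub>2n+E-m\<^esub>)\<close> that has a closed form,
  so that summing over \<open>n\<close> first leaves a theta series, evaluated by the Jacobi triple product.
  The closed forms follow from the two \<open>q\<close>-Pascal recurrences, because one of the neighbouring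
  sums always vanishes by antisymmetry. In the last two cases the theta series has base \<open>-q\<close>.
\<close>

section \<open>Infinite products\<close>

lemma has_prod_qpoch_inf:
  assumes "norm q < 1"
  shows "(\<lambda>k. 1 - a * q ^ k) has_prod qpoch_inf a q"
proof -
  have "summable (\<lambda>k. norm a * norm q ^ k)"
    using assms by (intro summable_mult summable_geometric) auto
  then have "summable (\<lambda>k. norm ((1 - a * q ^ k) - 1))"
    by (simp add: norm_mult norm_power)
  then have "abs_convergent_prod (\<lambda>k. 1 - a * q ^ k)"
    by (simp only: abs_convergent_prod_conv_summable)
  then show ?thesis
    unfolding qpoch_inf_def by (intro convergent_prod_has_prod abs_convergent_prod_imp_convergent_prod)
qed

lemma tendsto_qpoch:
  assumes "norm q < 1"
  shows "qpoch a q \<longlonglongrightarrow> qpoch_inf a q"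
  using has_prod_imp_tendsto'[OF has_prod_qpoch_inf[OF assms]]
  by (simp add: qpoch_def[abs_def])

lemma qpoch_0 [simp]: "qpoch a q 0 = 1"
  by (simp add: qpoch_def)

lemma qpoch_Suc: "qpoch a q (Suc n) = qpoch a q n * (1 - a * q ^ n)"
  by (simp add: qpoch_def)

lemma qpoch_add: "qpoch a q (m + n) = qpoch a q m * qpoch (a * q ^ m) q n"
  by (induction n) (auto simp: qpoch_Suc power_add mult_ac)

lemma qpoch_inf_split:
  assumes "norm q < 1"
  shows "qpoch_inf a q = qpoch a q n * qpoch_inf (a * q ^ n) q"
proof (rule LIMSEQ_unique)
  show "(\<lambda>m. qpoch a q (m + n)) \<longlonglongrightarrow> qpoch_inf a q"
    by (intro LIMSEQ_ignore_initial_segment tendsto_qpoch assms)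
  show "(\<lambda>m. qpoch a q (m + n)) \<longlonglongrightarrow> qpoch a q n * qpoch_inf (a * q ^ n) q"
    unfolding add.commute[of _ n] qpoch_add by (intro tendsto_intros tendsto_qpoch assms)
qed

text \<open>Factor by factor, (1 - a q^k)(1 + a q^k) = 1 - a^2 (q^2)^k. The infinite form below is
  what later removes minus signs from products.\<close>

lemma qpoch_minus: "qpoch a q n * qpoch (- a) q n = qpoch (a\<^sup>2) (q\<^sup>2) n"
  by (simp add: qpoch_def prod.distrib[symmetric] power2_eq_square power_mult_distrib algebra_simps)

lemma qpoch_inf_minus:
  assumes "norm q < 1"
  shows "qpoch_inf a q * qpoch_inf (- a) q = qpoch_inf (a\<^sup>2) (q\<^sup>2)"
proof (rule LIMSEQ_unique)
  show "(\<lambda>n. qpoch a q n * qpoch (- a) q n) \<longlonglongrightarrow> qpoch_inf a q * qpoch_inf (- a) q"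
    by (intro tendsto_intros tendsto_qpoch assms)
  have "norm (q\<^sup>2) < 1"
    using assms by (simp add: norm_power power_less_one_iff)
  then show "(\<lambda>n. qpoch a q n * qpoch (- a) q n) \<longlonglongrightarrow> qpoch_inf (a\<^sup>2) (q\<^sup>2)"
    unfolding qpoch_minus by (rule tendsto_qpoch)
qed

text \<open>The exponents below m n are grouped by their residue r modulo m.\<close>

lemma qpoch_mult: "qpoch a q (m * n) = (\<Prod>r<m. qpoch (a * q ^ r) (q ^ m) n)"
proof (induction n)
  case (Suc n)
  have "qpoch a q (m * Suc n) = qpoch a q (m * n) * (\<Prod>r<m. 1 - a * q ^ r * (q ^ m) ^ n)"
    using qpoch_add[of a q "m * n" m]
    by (simp add: qpoch_def power_mult[symmetric] mult_ac add.commute)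
  then show ?case
    by (simp add: Suc.IH qpoch_Suc prod.distrib)
qed simp

lemma qpoch_inf_dissect:
  assumes "norm q < 1" "m > 0"
  shows "qpoch_inf a q = (\<Prod>r<m. qpoch_inf (a * q ^ r) (q ^ m))"
proof (rule LIMSEQ_unique)
  \<comment> \<open>The finite dissection only controls lengths divisible by m, so the limit is
    taken along that subsequence.\<close>
  have "strict_mono ((*) m)"
    using assms by (intro strict_monoI) auto
  from LIMSEQ_subseq_LIMSEQ[OF tendsto_qpoch[OF assms(1)] this]
  show "(\<lambda>n. qpoch a q (m * n)) \<longlonglongrightarrow> qpoch_inf a q"
    by (simp add: o_def)
  have "norm (q ^ m) < 1"
    using assms by (simp add: norm_power power_less_one_iff)
  then show "(\<lambda>n. qpoch a q (m * n)) \<longlonglongrightarrow> (\<Prod>r<m. qpoch_inf (a * q ^ r) (q ^ m))"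
    unfolding qpoch_mult by (intro tendsto_intros tendsto_qpoch)
qed

lemma norm_power_lt_1:
  assumes "norm (q :: complex) < 1" "n > 0"
  shows "norm (q ^ n) < 1"
  using assms by (simp add: norm_power power_less_one_iff)

text \<open>A convergent product vanishes only through a zero factor, and |a q^k| < 1 rules that
  out.\<close>

lemma qpoch_inf_nonzero:
  assumes "norm q < 1" "norm a < 1"
  shows "qpoch_inf a q \<noteq> 0"
proof -
  have "a * q ^ k \<noteq> 1" for k
  proof
    assume "a * q ^ k = 1"
    then have "norm a * norm q ^ k = 1"
      by (metis norm_mult norm_one norm_power)
    moreover have "norm a * norm q ^ k \<le> norm a * 1"
      using assms by (intro mult_left_mono power_le_one) auto
    ultimately show False using assms by simp
  qed
  then show ?thesis
    using has_prod_eq_0_iff[OF has_prod_qpoch_inf[OF assms(1), of a]] by auto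
qed

lemma qpoch_nonzero:
  assumes "norm q < 1" "norm a < 1"
  shows "qpoch a q n \<noteq> 0"
  using qpoch_inf_split[OF assms(1), of a n] qpoch_inf_nonzero[OF assms] by auto

lemma tendsto_inverse_qpoch:
  assumes "norm q < 1"
  shows "(\<lambda>n. 1 / qpoch q q n) \<longlonglongrightarrow> 1 / qpoch_inf q q"
  by (intro tendsto_intros tendsto_qpoch assms qpoch_inf_nonzero)

text \<open>A uniform bound on the reciprocals lets every summability argument below ignore the
  denominators. The value at n = 0 forces K to be at least 1.\<close>

lemma inverse_qpoch_bounded:
  assumes "norm q < 1"
  obtains K where "K \<ge> 1" "\<And>n. norm (1 / qpoch q q n) \<le> K"
proof -
  from tendsto_inverse_qpoch[OF assms] have "Bseq (\<lambda>n. 1 / qpoch q q n)"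
    using convergent_imp_Bseq convergent_def by blast
  then obtain K where K: "\<And>n. norm (1 / qpoch q q n) \<le> K"
    using BseqE by metis
  from K[of 0] have "K \<ge> 1" by simp
  with K that show ?thesis by blast
qed

section \<open>Euler's and Cauchy's identities\<close>

lemma summable_power_choose_two:
  fixes r y :: real
  assumes "0 \<le> r" "r < 1" "0 \<le> y"
  shows "summable (\<lambda>j. r ^ (j choose 2) * y ^ j)"
proof -
  have "(\<lambda>j. y * r ^ j) \<longlonglongrightarrow> y * 0"
    using assms by (intro tendsto_intros LIMSEQ_power_zero) auto
  then have "eventually (\<lambda>j. y * r ^ j < 1 / 2) sequentially"
    by (intro order_tendstoD) auto
  then obtain N where N: "\<And>j. j \<ge> N \<Longrightarrow> y * r ^ j < 1 / 2"
    by (auto simp: eventually_sequentially)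
  show ?thesis
  proof (rule summable_ratio_test)
    fix j assume "j \<ge> N"
    have "r ^ (Suc j choose 2) * y ^ Suc j = (r ^ (j choose 2) * y ^ j) * (y * r ^ j)"
      by (simp add: numeral_2_eq_2 power_add mult_ac)
    also have "\<dots> \<le> (r ^ (j choose 2) * y ^ j) * (1 / 2)"
      using N[OF \<open>j \<ge> N\<close>] assms by (intro mult_left_mono) auto
    finally show "norm (r ^ (Suc j choose 2) * y ^ Suc j) \<le> 1 / 2 * norm (r ^ (j choose 2) * y ^ j)"
      using assms by (simp add: abs_mult)
  qed auto
qed

lemma euler_summable:
  assumes "norm q < 1"
  shows "summable (\<lambda>j. norm (q ^ (j choose 2) / qpoch q q j * x ^ j))"
proof -
  obtain K where K: "K \<ge> 1" "\<And>n. norm (1 / qpoch q q n) \<le> K"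
    using inverse_qpoch_bounded[OF assms] by blast
  have "summable (\<lambda>j. K * (norm q ^ (j choose 2) * norm x ^ j))"
    using assms by (intro summable_mult summable_power_choose_two) auto
  then show ?thesis
  proof (rule summable_comparison_test')
    fix j
    have "norm (q ^ (j choose 2) / qpoch q q j * x ^ j) =
      norm (1 / qpoch q q j) * (norm q ^ (j choose 2) * norm x ^ j)"
      by (simp add: norm_mult norm_divide norm_power)
    also have "\<dots> \<le> K * (norm q ^ (j choose 2) * norm x ^ j)"
      using K by (intro mult_right_mono) auto
    finally show "norm (norm (q ^ (j choose 2) / qpoch q q j * x ^ j)) \<le>
      K * (norm q ^ (j choose 2) * norm x ^ j)" by simp
  qed
qed

text \<open>The power series E satisfies E(x) = (1 + x) E(x q), the functional equation of the
  product. Iterating it and using continuity at 0 with E(0) = 1 identifies the two.\<close>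

lemma has_sum_euler:
  assumes q: "norm q < 1"
  shows "((\<lambda>j. q ^ (j choose 2) / qpoch q q j * x ^ j) has_sum qpoch_inf (- x) q) UNIV"
proof -
  define a where "a = (\<lambda>j. q ^ (j choose 2) / qpoch q q j)"
  define E where "E = (\<lambda>x. \<Sum>j. a j * x ^ j)"
  have sum: "summable (\<lambda>j. a j * x ^ j)" for x
    using summable_norm_cancel[OF euler_summable[OF q, of x]] by (simp add: a_def)
  have nz: "qpoch q q n \<noteq> 0" for n
    using qpoch_nonzero[OF q q] .
  \<comment> \<open>The coefficient recursion that encodes the functional equation.\<close>
  have a_Suc: "a (Suc j) * (1 - q ^ Suc j) = a j * q ^ j" for j
    using nz[of j] nz[of "Suc j"]
    by (simp add: a_def qpoch_Suc numeral_2_eq_2 power_add divide_simps)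
  have step: "E x = (1 + x) * E (x * q)" for x
  proof -
    have "E x - E (x * q) = (\<Sum>j. a j * (1 - q ^ j) * x ^ j)"
      unfolding E_def
      by (subst suminf_diff[OF sum sum]) (simp add: algebra_simps power_mult_distrib)
    also have "\<dots> = (\<Sum>j. a (Suc j) * (1 - q ^ Suc j) * x ^ Suc j)"
      using summable_diff[OF sum[of x] sum[of "x * q"]]
      by (subst suminf_split_head) (auto simp: algebra_simps power_mult_distrib)
    also have "\<dots> = (\<Sum>j. x * (a j * (x * q) ^ j))"
      unfolding a_Suc by (simp add: power_mult_distrib mult_ac)
    also have "\<dots> = x * E (x * q)"
      unfolding E_def by (rule suminf_mult[OF sum])
    finally show ?thesis by (simp add: algebra_simps)
  qed
  have iter: "E x = qpoch (- x) q n * E (x * q ^ n)" for n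
  proof (induction n)
    case (Suc n)
    then show ?case
      using step[of "x * q ^ n"] by (simp add: qpoch_Suc mult_ac)
  qed simp
  have "isCont E 0"
    unfolding E_def by (rule isCont_powser_converges_everywhere[OF sum])
  moreover have "(\<lambda>n. x * q ^ n) \<longlonglongrightarrow> x * 0"
    by (intro tendsto_intros LIMSEQ_power_zero q)
  ultimately have "(\<lambda>n. E (x * q ^ n)) \<longlonglongrightarrow> E 0"
    using isCont_tendsto_compose by fastforce
  then have "(\<lambda>n. qpoch (- x) q n * E (x * q ^ n)) \<longlonglongrightarrow> qpoch_inf (- x) q * E 0"
    by (intro tendsto_intros tendsto_qpoch q)
  then have "E x = qpoch_inf (- x) q * E 0"
    unfolding iter[symmetric] by (simp add: LIMSEQ_const_iff)
  moreover have "E 0 = 1"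
    unfolding E_def using powser_zero[of a] by (simp add: a_def numeral_2_eq_2)
  ultimately have "(\<lambda>j. a j * x ^ j) sums qpoch_inf (- x) q"
    using summable_sums[OF sum[of x]] by (simp add: E_def)
  then show ?thesis
    using norm_summable_imp_has_sum[OF euler_summable[OF q, of x]] by (simp add: a_def)
qed

text \<open>In each of the first i factors, 1 + x/q^(k+1) = (x/q^(k+1)) (1 + (q/x) q^k). The
  extracted powers of q have exponents 1, ..., i. After Euler summation over j this isolates an
  infinite product that is free of i.\<close>

lemma qpoch_inf_shift:
  assumes "norm q < 1" "q \<noteq> 0" "x \<noteq> 0"
  shows "qpoch_inf (- (x / q ^ i)) q =
    x ^ i / q ^ (Suc i choose 2) * qpoch (- (q / x)) q i * qpoch_inf (- x) q"
proof -
  have "qpoch (- (x / q ^ i)) q i = x ^ i / q ^ (Suc i choose 2) * qpoch (- (q / x)) q i"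
  proof (induction i)
    case (Suc i)
    have "qpoch (- (x / q ^ Suc i)) q (Suc i) = (1 + x / q ^ Suc i) * qpoch (- (x / q ^ i)) q i"
      using qpoch_add[of "- (x / q ^ Suc i)" q 1 i] assms by (simp add: qpoch_Suc)
    also have "1 + x / q ^ Suc i = x / q ^ Suc i * (1 + q / x * q ^ i)"
      using assms by (simp add: field_simps)
    finally show ?case
      unfolding Suc.IH using assms
      by (simp add: qpoch_Suc numeral_2_eq_2 power_add mult_ac)
  qed (simp add: numeral_2_eq_2)
  then show ?thesis
    using qpoch_inf_split[OF assms(1), of "- (x / q ^ i)" i] assms by simp
qed

text \<open>The value does not depend on \<open>M\<close>: the differences \<open>D\<^sub>M\<close> of consecutive values satisfy
  \<open>D\<^sub>M = - q\<^bsup>M+1\<^esup> D\<^sub>M\<^sub>+\<^sub>1\<close>, hence vanish. The limit \<open>M \<rightarrow> \<infinity>\<close> keeps only the term \<open>s = 0\<close>.\<close>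

lemma has_sum_cauchy:
  assumes q: "norm q < 1"
  shows "((\<lambda>s. q ^ (s\<^sup>2 + M * s) / (qpoch q q s * qpoch q q (s + M))) has_sum 1 / qpoch_inf q q) UNIV"
proof -
  define r where "r = norm q"
  have r: "0 \<le> r" "r < 1" using q by (auto simp: r_def)
  obtain K where K: "K \<ge> 1" "\<And>n. norm (1 / qpoch q q n) \<le> K"
    using inverse_qpoch_bounded[OF q] by blast
  have nz: "qpoch q q n \<noteq> 0" for n
    using qpoch_nonzero[OF q q] .
  define t where "t = (\<lambda>M s. q ^ (s\<^sup>2 + M * s) / (qpoch q q s * qpoch q q (s + M)))"
  have t_le: "norm (t M s) \<le> K\<^sup>2 * r ^ n" if "n \<le> s\<^sup>2 + M * s" for M s n
  proof -
    have "norm (t M s) = norm (1 / qpoch q q s) * norm (1 / qpoch q q (s + M)) * r ^ (s\<^sup>2 + M * s)"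
      by (simp add: t_def r_def norm_mult norm_divide norm_power)
    also have "\<dots> \<le> (K * K) * r ^ n"
      using K r that by (intro mult_mono power_decreasing) (auto intro: order.trans[of 0 1])
    finally show ?thesis by (simp add: power2_eq_square)
  qed
  have s2: "s \<le> s\<^sup>2" for s :: nat
    by (simp add: power2_eq_square)
  have geo: "summable (\<lambda>s. c * r ^ s)" for c
    using r by (intro summable_mult summable_geometric) auto
  have summ: "summable (\<lambda>s. norm (t M s))" for M
    by (rule summable_comparison_test'[OF geo[of "K\<^sup>2"], of 0])
       (simp add: t_le[OF trans_le_add1[OF s2]])
  have summ_Suc: "summable (\<lambda>s. norm (t M (Suc s)))" for M
    using summable_Suc_iff[of "\<lambda>s. norm (t M s)"] summ[of M] by blast
  note sums = summable_sums[OF summable_norm_cancel[OF summ]]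
  define C where "C = (\<lambda>M. \<Sum>s. t M s)"
  \<comment> \<open>The value of the geometric majorant with terms \<open>K\<^sup>2 * r ^ s\<close>,
    hence a bound on all \<open>C M\<close> at once.\<close>
  define B where "B = K\<^sup>2 / (1 - r)"
  have suminf_geo: "(\<Sum>s. c * r ^ s) = c / (1 - r)" for c
    using r by (subst suminf_mult) (auto intro: summable_geometric simp: suminf_geometric)
  have C_le: "norm (C M) \<le> B" for M
  proof -
    have "norm (C M) \<le> (\<Sum>s. norm (t M s))"
      unfolding C_def by (rule summable_norm[OF summ])
    also have "\<dots> \<le> (\<Sum>s. K\<^sup>2 * r ^ s)"
      by (intro suminf_le summ geo t_le) (use s2 in \<open>auto intro: trans_le_add1\<close>)
    finally show ?thesis by (simp add: suminf_geo B_def)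
  qed
  \<comment> \<open>The subtracted quotient is the term s = 0. The exponent of every later term
    exceeds M by enough to leave a factor r^M times a geometric series.\<close>
  have C_lim: "norm (C M - 1 / qpoch q q M) \<le> B * r ^ M" for M
  proof -
    have "C M - 1 / qpoch q q M = (\<Sum>s. t M (Suc s))"
      unfolding C_def using suminf_split_head[OF summable_norm_cancel[OF summ[of M]]]
      by (simp add: t_def)
    also have "norm \<dots> \<le> (\<Sum>s. norm (t M (Suc s)))"
      by (rule summable_norm[OF summ_Suc])
    also have "\<dots> \<le> (\<Sum>s. (K\<^sup>2 * r ^ M) * r ^ s)"
    proof (intro suminf_le geo)
      fix s
      have "norm (t M (Suc s)) \<le> K\<^sup>2 * r ^ (M + s)"
        by (rule t_le) (simp add: power2_eq_square)
      then show "norm (t M (Suc s)) \<le> K\<^sup>2 * r ^ M * r ^ s"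
        by (simp add: power_add mult_ac)
    qed (rule summ_Suc)
    finally show ?thesis by (simp add: suminf_geo B_def)
  qed
  define D where "D = (\<lambda>M. C M - C (Suc M))"
  have D_step: "D M = - (q ^ Suc M) * D (Suc M)" for M
  proof -
    \<comment> \<open>\<open>A\<close> is summed in two ways. Over the common denominator it is a
      combination of \<open>t M\<close> and \<open>t (Suc M)\<close>; on the other hand 1 - q^s
      kills its term s = 0 and cancels a factor of (q;q)_s, so that the shifted \<open>A\<close> is
      a multiple of \<open>t (Suc (Suc M))\<close>.\<close>
    define A where "A = (\<lambda>s. q ^ (s\<^sup>2 + M * s) * (1 - q ^ s) / (qpoch q q s * qpoch q q (s + Suc M)))"
    have A_eq: "A s = t M s - t (Suc M) s + q ^ Suc M * t (Suc M) s" for s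
      using nz[of s] nz[of "s + M"] nz[of "s + Suc M"]
      by (simp add: A_def t_def qpoch_Suc divide_simps) (simp add: algebra_simps power_add)
    have A_Suc: "A (Suc s) = q ^ Suc M * t (Suc (Suc M)) s" for s
      using nz[of s] nz[of "Suc s"]
      by (simp add: A_def t_def qpoch_Suc divide_simps power2_eq_square)
         (simp add: algebra_simps power_add)
    have "A sums (C M - C (Suc M) + q ^ Suc M * C (Suc M))"
      unfolding A_eq C_def by (intro sums_add sums_diff sums_mult sums)
    moreover have "(\<lambda>s. A (Suc s)) sums (q ^ Suc M * C (Suc (Suc M)))"
      unfolding A_Suc C_def by (intro sums_mult sums)
    then have "A sums (q ^ Suc M * C (Suc (Suc M)))"
      by (subst (asm) sums_Suc_iff) (simp add: A_def)
    ultimately have "C M - C (Suc M) + q ^ Suc M * C (Suc M) = q ^ Suc M * C (Suc (Suc M))"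
      by (rule sums_unique2)
    then show ?thesis by (simp add: D_def algebra_simps)
  qed
  have D_le: "norm (D M) \<le> r ^ n * norm (D (M + n))" for M n
  proof (induction n)
    case (Suc n)
    have "norm (D (M + n)) = r ^ Suc (M + n) * norm (D (M + Suc n))"
      by (subst D_step) (simp add: norm_mult norm_power r_def)
    also have "\<dots> \<le> r ^ 1 * norm (D (M + Suc n))"
      using r by (intro mult_right_mono power_decreasing) auto
    finally have "r ^ n * norm (D (M + n)) \<le> r ^ n * (r * norm (D (M + Suc n)))"
      using r by (intro mult_left_mono) auto
    with Suc.IH show ?case by (simp add: mult_ac)
  qed simp
  have D_0: "D M = 0" for M
  proof -
    \<comment> \<open>Each use of the recursion gains at least a factor r, while \<open>D\<close>
      stays bounded by 2 B.\<close>
    have "norm (D M) \<le> r ^ n * (2 * B)" for n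
    proof -
      have "norm (D (M + n)) \<le> 2 * B"
        using norm_triangle_ineq4[of "C (M + n)" "C (Suc (M + n))"] C_le[of "M + n"] C_le[of "Suc (M + n)"]
        by (simp add: D_def)
      then have "r ^ n * norm (D (M + n)) \<le> r ^ n * (2 * B)"
        using r by (intro mult_left_mono) auto
      with D_le[of M n] show ?thesis by linarith
    qed
    moreover have "(\<lambda>n. r ^ n * (2 * B)) \<longlonglongrightarrow> 0 * (2 * B)"
      using r by (intro tendsto_intros LIMSEQ_power_zero) auto
    ultimately have "norm (D M) \<le> 0"
      by (intro LIMSEQ_le_const[of _ 0]) auto
    then show ?thesis by simp
  qed
  have C_const: "C n = C 0" for n
    by (induction n) (use D_0 in \<open>auto simp: D_def\<close>)
  have "(\<lambda>M. C M - 1 / qpoch q q M) \<longlonglongrightarrow> 0"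
  proof (rule Lim_null_comparison)
    show "\<forall>\<^sub>F M in sequentially. norm (C M - 1 / qpoch q q M) \<le> B * r ^ M"
      using C_lim by auto
    show "(\<lambda>M. B * r ^ M) \<longlonglongrightarrow> 0"
      using r by (intro tendsto_mult_right_zero LIMSEQ_power_zero) auto
  qed
  from tendsto_add[OF this tendsto_inverse_qpoch[OF q]]
  have "C \<longlonglongrightarrow> 1 / qpoch_inf q q" by simp
  moreover have "C n = C M" for n
    by (rule trans[OF C_const C_const[symmetric]])
  then have "C \<longlonglongrightarrow> C M"
    by (intro tendsto_eventually always_eventually allI)
  ultimately have "C M = 1 / qpoch_inf q q"
    using LIMSEQ_unique by blast
  then show ?thesis
    using norm_summable_imp_has_sum[OF summ[of M] sums[of M]] by (simp add: C_def t_def)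
qed

section \<open>Jacobi triple product and Bailey's lemma\<close>

lemma abs_summable_on_Times:
  fixes f :: "'a \<Rightarrow> complex" and g :: "'b \<Rightarrow> complex"
  assumes "(\<lambda>x. norm (f x)) summable_on A" "(\<lambda>x. norm (g x)) summable_on B"
  shows "(\<lambda>z. norm (case z of (x, y) \<Rightarrow> f x * g y)) summable_on A \<times> B"
proof (rule summable_on_SigmaI)
  fix x
  show "((\<lambda>y. norm (case (x, y) of (x, y) \<Rightarrow> f x * g y)) has_sum
      norm (f x) * infsum (\<lambda>y. norm (g y)) B) B"
    using has_sum_cmult_right[OF has_sum_infsum[OF assms(2)], of "norm (f x)"]
    by (simp add: norm_mult)
next
  show "(\<lambda>x. norm (f x) * infsum (\<lambda>y. norm (g y)) B) summable_on A"
    by (rule summable_on_cmult_left[OF assms(1)])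
qed auto

lemma has_sum_Times:
  fixes f :: "'a \<Rightarrow> complex" and g :: "'b \<Rightarrow> complex"
  assumes "(f has_sum x) A" "(g has_sum y) B"
  shows "((\<lambda>(a, b). f a * g b) has_sum x * y) (A \<times> B)"
proof (rule has_sum_SigmaI)
  show "(\<lambda>(a, b). f a * g b) summable_on A \<times> B"
    using has_sum_imp_summable[OF assms(1)] has_sum_imp_summable[OF assms(2)]
    unfolding summable_on_iff_abs_summable_on_complex by (rule abs_summable_on_Times)
  show "((\<lambda>b. case (a, b) of (a, b) \<Rightarrow> f a * g b) has_sum f a * y) B" for a
    using has_sum_cmult_right[OF assms(2)] by simp
  show "((\<lambda>a. f a * y) has_sum x * y) A"
    by (rule has_sum_cmult_left[OF assms(1)])
qed

text \<open>The majorant is a product of two geometric series. A general index set \<open>A\<close>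
  admits the triangular range of Bailey's lemma as well as the full quadrant.\<close>

lemma summable_on_geometric_bound:
  fixes f :: "nat \<times> nat \<Rightarrow> complex"
  assumes t: "0 \<le> t" "t < 1"
    and bound: "\<And>i j. (i, j) \<in> A \<Longrightarrow> norm (f (i, j)) \<le> c * t ^ (i + j)"
  shows "f summable_on A"
proof (rule Infinite_Sum.abs_summable_summable, rule Infinite_Sum.abs_summable_on_comparison_test)
  have "summable (\<lambda>n. norm (complex_of_real t ^ n))"
    using t by (simp add: norm_power summable_geometric)
  then have "(\<lambda>n. norm (complex_of_real t ^ n)) summable_on UNIV"
    by (intro summable_nonneg_imp_summable_on) auto
  from abs_summable_on_Times[OF this this]
  have "(\<lambda>x. norm (case x of (i, j) \<Rightarrow> complex_of_real t ^ i * complex_of_real t ^ j)) summable_on UNIV"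
    by simp
  \<comment> \<open>The sign of c is left open, so the majorant carries its absolute value.\<close>
  then have "(\<lambda>x. \<bar>c\<bar> * norm (case x of (i, j) \<Rightarrow> complex_of_real t ^ i * complex_of_real t ^ j)) summable_on UNIV"
    by (rule summable_on_cmult_right)
  then have "(\<lambda>x. \<bar>c\<bar> * norm (case x of (i, j) \<Rightarrow> complex_of_real t ^ i * complex_of_real t ^ j)) summable_on A"
    by (rule summable_on_subset_banach) auto
  then show "(\<lambda>x. norm (of_real c * (case x of (i, j) \<Rightarrow> complex_of_real t ^ i * complex_of_real t ^ j))) summable_on A"
    by (simp add: norm_mult)
  show "norm (f x) \<le> norm (of_real c * (case x of (i, j) \<Rightarrow> complex_of_real t ^ i * complex_of_real t ^ j))"
    if "x \<in> A" for x
  proof -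
    obtain i j where x: "x = (i, j)" by (cases x)
    have "norm (f x) \<le> c * t ^ (i + j)"
      using bound that x by auto
    also have "\<dots> \<le> \<bar>c\<bar> * t ^ (i + j)"
      using t by (intro mult_right_mono) auto
    finally show ?thesis
      using t by (simp add: x norm_mult norm_power power_add)
  qed
qed

text \<open>Splits the exponent of a product of two Euler terms whose indices differ by n into the
  Cauchy exponent s^2 + n s and the theta exponent. The extra s comes from (q/z)^s.\<close>

lemma choose_two_add:
  "(s + n choose 2) + (s choose 2) + s = s\<^sup>2 + n * s + (n choose 2)"
proof (induction s)
  case (Suc s)
  have "(Suc s + n choose 2) = (s + n) + (s + n choose 2)" "(Suc s choose 2) = s + (s choose 2)"
    by (auto simp: numeral_2_eq_2)
  with Suc show ?case by (simp add: power2_eq_square)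
qed (simp add: numeral_2_eq_2)

lemma int_choose_two: "int (n choose 2) = (int n ^ 2 - int n) div 2"
proof -
  have "2 * int (n choose 2) = int n ^ 2 - int n"
    by (induction n) (auto simp: numeral_2_eq_2 algebra_simps)
  then show ?thesis by simp
qed

text \<open>Multiply two instances of Euler's identity, with indices \<open>a\<close> and \<open>b\<close>, and group the terms by \<open>k = a - b\<close>;
  each group is a Cauchy sum.\<close>

lemma jacobi_triple:
  assumes q: "norm q < 1" "q \<noteq> 0" and z: "z \<noteq> 0"
  shows "((\<lambda>k::int. (- z) powi k * q powi ((k\<^sup>2 - k) div 2)) has_sum
    qpoch_inf z q * qpoch_inf (q / z) q * qpoch_inf q q) UNIV"
proof -
  define f where "f = (\<lambda>(a, b). (q ^ (a choose 2) / qpoch q q a * (- z) ^ a) *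
    (q ^ (b choose 2) / qpoch q q b * (- (q / z)) ^ b))"
  \<comment> \<open>\<open>\<phi>\<close> yields the pair with difference k and minimum s;
    \<open>\<psi>\<close> recovers both numbers.\<close>
  define \<phi> where "\<phi> = (\<lambda>(k :: int, s). (s + nat k, s + nat (- k)))"
  define \<psi> where "\<psi> = (\<lambda>(a, b). (int a - int b, min a b))"
  let ?P = "qpoch_inf z q * qpoch_inf (q / z) q"
  have "(f has_sum ?P) (UNIV \<times> UNIV)"
    unfolding f_def using has_sum_Times[OF has_sum_euler[OF q(1), of "- z"] has_sum_euler[OF q(1), of "- (q / z)"]]
    by simp
  moreover have "((\<lambda>x. f (\<phi> x)) has_sum ?P) (UNIV \<times> UNIV) = (f has_sum ?P) (UNIV \<times> UNIV)"
    by (rule has_sum_reindex_bij_witness[of _ \<psi> \<phi>]) (auto simp: \<phi>_def \<psi>_def min_def)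
  ultimately have "((\<lambda>x. f (\<phi> x)) has_sum ?P) (UNIV \<times> UNIV)"
    by simp
  then have "((\<lambda>k. (- z) powi k * q powi ((k\<^sup>2 - k) div 2) * (1 / qpoch_inf q q)) has_sum ?P) UNIV"
  proof (rule has_sum_SigmaD)
    fix k :: int
    have "f (\<phi> (k, s)) = (- z) powi k * q powi ((k\<^sup>2 - k) div 2) *
      (q ^ (s\<^sup>2 + nat \<bar>k\<bar> * s) / (qpoch q q s * qpoch q q (s + nat \<bar>k\<bar>)))" for s
    proof (cases k)
      case (nonneg n)
      have "q ^ (s + n choose 2) * q ^ (s choose 2) * q ^ s = q ^ (s\<^sup>2 + n * s) * q ^ (n choose 2)"
        by (simp flip: power_add choose_two_add)
      moreover have "(- z) ^ (s + n) * (- (q / z)) ^ s = (- z) ^ n * q ^ s"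
        using z by (simp add: power_add flip: power_mult_distrib)
      moreover have "q powi ((k\<^sup>2 - k) div 2) = q ^ (n choose 2)"
        using nonneg by (simp flip: int_choose_two)
      moreover have "f (\<phi> (k, s)) = ((- z) ^ (s + n) * (- (q / z)) ^ s) *
        (q ^ (s + n choose 2) * q ^ (s choose 2)) / (qpoch q q s * qpoch q q (s + n))"
        using nonneg by (simp add: f_def \<phi>_def mult_ac)
      ultimately show ?thesis
        using nonneg by (simp add: mult_ac)
    next
      case (neg m)
      \<comment> \<open>With k = -n the second index is the larger one, so q/z contributes q^(s+n),
        and (k^2 - k)/2 = n + n(n-1)/2.\<close>
      define n where "n = Suc m"
      have k: "k = - int n" using neg by (simp add: n_def)
      have "q ^ (s + n choose 2) * q ^ (s choose 2) * q ^ (s + n) = q ^ (s\<^sup>2 + n * s) * q ^ (n + (n choose 2))"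
      proof -
        have "(s + n choose 2) + (s choose 2) + (s + n) = s\<^sup>2 + n * s + (n + (n choose 2))"
          using choose_two_add[of s n] by linarith
        then show ?thesis by (simp only: flip: power_add)
      qed
      moreover have "(- z) ^ s * (- (q / z)) ^ (s + n) = (- z) powi k * q ^ (s + n)"
      proof -
        have "(- z) ^ s * (- (q / z)) ^ (s + n) = ((- z) * (- (q / z))) ^ s * ((- q) ^ n / z ^ n)"
          by (simp only: power_add power_mult_distrib power_divide[symmetric] minus_divide_left mult.assoc)
        also have "\<dots> = q ^ s * (q ^ n / (- z) ^ n)"
          using z by (cases "even n") simp_all
        finally show ?thesis
          by (simp add: k power_add power_int_minus divide_simps)
      qed
      moreover have "q powi ((k\<^sup>2 - k) div 2) = q ^ (n + (n choose 2))"
      proof -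
        have "k\<^sup>2 - k = (int n ^ 2 - int n) + int n * 2"
          by (simp add: k)
        then have "(k\<^sup>2 - k) div 2 = int (n + (n choose 2))"
          unfolding of_nat_add int_choose_two by simp
        then show ?thesis by (simp only: power_int_of_nat)
      qed
      moreover have "f (\<phi> (k, s)) = ((- z) ^ s * (- (q / z)) ^ (s + n)) *
        (q ^ (s + n choose 2) * q ^ (s choose 2)) / (qpoch q q s * qpoch q q (s + n))"
        using k by (simp add: f_def \<phi>_def mult_ac)
      ultimately show ?thesis
        using k by (simp add: mult_ac)
    qed
    then show "((\<lambda>s. f (\<phi> (k, s))) has_sum
      (- z) powi k * q powi ((k\<^sup>2 - k) div 2) * (1 / qpoch_inf q q)) UNIV"
      using has_sum_cmult_right[OF has_sum_cauchy[OF q(1)]] by simp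
  qed
  from has_sum_cmult_left[OF this, of "qpoch_inf q q"]
  show ?thesis
    using qpoch_inf_nonzero[OF q(1) q(1)] by simp
qed

text \<open>A limiting case of Bailey's lemma with parameter a = q^E, in bilateral form. Grouping
  the pairs (n, m) by j = m - n - E turns the inner sum for each j into a Cauchy sum.\<close>

lemma has_sum_bailey:
  fixes d :: "int \<Rightarrow> complex"
  assumes q: "norm q < 1" "q \<noteq> 0" and E: "E \<le> 1" and d: "\<And>j. norm (d j) \<le> B"
    and T: "((\<lambda>j. d j * q powi (j\<^sup>2 + int E * j)) has_sum T) UNIV"
  shows "((\<lambda>n. q ^ (n\<^sup>2 + E * n) *
      (\<Sum>m\<le>2 * n + E. d (int m - int n - int E) / (qpoch q q m * qpoch q q (2 * n + E - m))))
    has_sum T / qpoch_inf q q) UNIV"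
proof -
  obtain K where K: "K \<ge> 1" "\<And>n. norm (1 / qpoch q q n) \<le> K"
    using inverse_qpoch_bounded[OF q(1)] by blast
  define f where "f = (\<lambda>(n, m). q ^ (n\<^sup>2 + E * n) *
    (d (int m - int n - int E) / (qpoch q q m * qpoch q q (2 * n + E - m))))"
  let ?A = "SIGMA n:UNIV. {..2 * n + E}"
  have "f summable_on ?A"
  proof (rule summable_on_geometric_bound)
    \<comment> \<open>The square root doubles the exponent n^2, and 2 n^2 + 3 dominates n + m, which
      can reach 3 n + 1.\<close>
    define t where "t = sqrt (norm q)"
    show t: "0 \<le> t" "t < 1" using q by (auto simp: t_def)
    have "t > 0" using q by (simp add: t_def)
    have "B \<ge> 0" using d[of 0] norm_ge_zero order.trans by blast
    fix n m assume "(n, m) \<in> ?A"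
    then have "m \<le> 2 * n + 1" using E by auto
    have "int n + int m \<le> 3 + 2 * int n ^ 2"
    proof -
      have "int n + int m \<le> 3 * int n + 1" using \<open>m \<le> 2 * n + 1\<close> by simp
      also have "\<dots> \<le> 3 + 2 * int n ^ 2"
        using zero_le_power2[of "int n - 1"] by (simp add: power2_eq_square algebra_simps)
      finally show ?thesis .
    qed
    then have le: "n + m \<le> 3 + 2 * n\<^sup>2"
      by (metis (mono_tags, lifting) of_nat_add of_nat_le_iff of_nat_mult of_nat_numeral of_nat_power)
    have "norm q ^ (n\<^sup>2 + E * n) \<le> norm q ^ n\<^sup>2"
      using q by (intro power_decreasing) auto
    also have "\<dots> = t ^ (2 * n\<^sup>2)"
      by (simp add: t_def power_mult)
    also have "\<dots> = t ^ (3 + 2 * n\<^sup>2) / t ^ 3"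
      using \<open>t > 0\<close> by (simp add: power_add)
    also have "\<dots> \<le> t ^ (n + m) / t ^ 3"
      using t \<open>t > 0\<close> le by (intro divide_right_mono power_decreasing) auto
    finally have "norm q ^ (n\<^sup>2 + E * n) \<le> t ^ (n + m) / t ^ 3" .
    then have "norm q ^ (n\<^sup>2 + E * n) * (norm (d (int m - int n - int E)) *
       (norm (1 / qpoch q q m) * norm (1 / qpoch q q (2 * n + E - m)))) \<le>
       t ^ (n + m) / t ^ 3 * (B * (K * K))"
      using K d t \<open>B \<ge> 0\<close> by (intro mult_mono) auto
    then show "norm (f (n, m)) \<le> B * (K * K) / t ^ 3 * t ^ (n + m)"
      by (simp add: f_def norm_mult norm_divide norm_power mult_ac)
  qed
  then obtain S where S: "(f has_sum S) ?A"
    using has_sum_infsum by blast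
  \<comment> \<open>Here s is the smaller of the two subscripts m and 2n + E - m. For j < 0 the
    natural subtraction of E is exact because E \<le> 1 \<le> -j.\<close>
  define \<phi> where "\<phi> = (\<lambda>(j :: int, s). if j \<ge> 0 then (s + nat j, s + 2 * nat j + E)
    else (s + nat (- j) - E, s))"
  define \<psi> where "\<psi> = (\<lambda>(n, m). (int m - int n - int E, min m (2 * n + E - m)))"
  have "((\<lambda>x. f (\<phi> x)) has_sum S) (UNIV \<times> UNIV) = (f has_sum S) ?A"
    by (rule has_sum_reindex_bij_witness[of _ \<psi> \<phi>])
       (use E in \<open>auto simp: \<phi>_def \<psi>_def min_def split: if_splits\<close>)
  with S have "((\<lambda>x. f (\<phi> x)) has_sum S) (UNIV \<times> UNIV)"
    by simp
  then have "((\<lambda>j. d j * q powi (j\<^sup>2 + int E * j) * (1 / qpoch_inf q q)) has_sum S) UNIV"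
  proof (rule has_sum_SigmaD)
    fix j :: int
    \<comment> \<open>The distance between the subscripts m and 2n + E - m when m - n - E =
      j.\<close>
    define M where "M = nat \<bar>2 * j + int E\<bar>"
    have "f (\<phi> (j, s)) = d j * q powi (j\<^sup>2 + int E * j) *
      (q ^ (s\<^sup>2 + M * s) / (qpoch q q s * qpoch q q (s + M)))" for s
    proof (cases "j \<ge> 0")
      case True
      then obtain i where j: "j = int i" by (metis nonneg_int_cases)
      have M: "M = 2 * i + E" by (simp add: M_def j)
      have "(s + i)\<^sup>2 + E * (s + i) = (i\<^sup>2 + E * i) + (s\<^sup>2 + M * s)"
        unfolding M by (simp add: power2_eq_square algebra_simps)
      moreover have "j\<^sup>2 + int E * j = int (i\<^sup>2 + E * i)"
        unfolding j by simp
      ultimately have "q ^ ((s + i)\<^sup>2 + E * (s + i)) = q powi (j\<^sup>2 + int E * j) * q ^ (s\<^sup>2 + M * s)"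
        by (simp only: power_add power_int_of_nat)
      moreover have "2 * (s + i) + E - (s + 2 * i + E) = s" by simp
      ultimately show ?thesis
        unfolding f_def \<phi>_def by (simp add: j M mult_ac add_ac)
    next
      case False
      then obtain i where j: "j = - int (i + E)" and i: "i + E > 0"
        using E by (intro that[of "nat (- j - int E)"]) auto
      have M: "M = 2 * i + E" using i by (simp add: M_def j)
      have "(s + i)\<^sup>2 + E * (s + i) = (i\<^sup>2 + E * i) + (s\<^sup>2 + M * s)"
        unfolding M by (simp add: power2_eq_square algebra_simps)
      moreover have "j\<^sup>2 + int E * j = int (i\<^sup>2 + E * i)"
        unfolding j by (simp add: power2_eq_square algebra_simps)
      ultimately have "q ^ ((s + i)\<^sup>2 + E * (s + i)) = q powi (j\<^sup>2 + int E * j) * q ^ (s\<^sup>2 + M * s)"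
        by (simp only: power_add power_int_of_nat)
      moreover have "\<phi> (j, s) = (s + i, s)"
        using False by (simp add: \<phi>_def j)
      moreover have "int s - int (s + i) - int E = j" "2 * (s + i) + E - s = s + M"
        by (simp_all add: j M)
      ultimately show ?thesis
        unfolding f_def by (simp only: prod.case) (simp add: mult_ac)
    qed
    then show "((\<lambda>s. f (\<phi> (j, s))) has_sum
      d j * q powi (j\<^sup>2 + int E * j) * (1 / qpoch_inf q q)) UNIV"
      using has_sum_cmult_right[OF has_sum_cauchy[OF q(1)]] by simp
  qed
  moreover have "((\<lambda>j. d j * q powi (j\<^sup>2 + int E * j) * (1 / qpoch_inf q q)) has_sum
    T * (1 / qpoch_inf q q)) UNIV"
    by (rule has_sum_cmult_left[OF T])
  ultimately have "S = T / qpoch_inf q q"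
    using has_sum_unique by fastforce
  with S have "(f has_sum T / qpoch_inf q q) ?A" by simp
  then show ?thesis
    by (rule has_sum_SigmaD) (auto simp: f_def sum_distrib_left intro!: has_sum_finiteI)
qed

section \<open>Closed forms of the finite sums\<close>

lemma powi_add: "(x :: complex) \<noteq> 0 \<Longrightarrow> x powi (m + n) = x powi m * x powi n"
  by (simp add: power_int_add)

text \<open>Chains the recurrence steps from length 2n to 2n + 1 and on to 2n + 2. The abstract
  field variables keep large q-expressions out of the division.\<close>

lemma eq_divide_two_steps:
  fixes x y z :: "'a :: field"
  assumes "c2 * x = b * y" "c1 * y = z" "c1 \<noteq> 0" "c2 \<noteq> 0"
  shows "x = b * z / (c1 * c2)"
proof -
  have "y = z / c1" "x = b * y / c2"
    using assms by (auto simp: field_simps)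
  then show ?thesis by simp
qed

text \<open>Up to the factor (q;q)_N this is a sum of weighted q-binomial coefficients. The weights
  live on the integers because shifts and reflections leave the range 0, ..., N.\<close>

definition bsum :: "complex \<Rightarrow> nat \<Rightarrow> (int \<Rightarrow> complex) \<Rightarrow> complex" where
  "bsum q N w = (\<Sum>m\<le>N. w (int m) / (qpoch q q m * qpoch q q (N - m)))"

lemma bsum_cong: "(\<And>m. w m = w' m) \<Longrightarrow> bsum q N w = bsum q N w'"
  by (simp add: bsum_def)

lemma bsum_cmult: "bsum q N (\<lambda>m. c * w m) = c * bsum q N w"
  by (simp add: bsum_def sum_distrib_left)

lemma bsum_reflect: "bsum q N w = bsum q N (\<lambda>m. w (int N - m))"
  unfolding bsum_def
  by (rule sum.reindex_bij_witness[of _ "\<lambda>m. N - m" "\<lambda>m. N - m"]) (auto simp: of_nat_diff mult.commute)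

text \<open>Write 1 - q^(N+1) = (1 - q^m) + q^m (1 - q^(N+1-m)). Each bracket cancels the last
  factor of one denominator and kills one end of the sum.\<close>

lemma bsum_pascal:
  assumes q: "norm q < 1"
  shows "(1 - q ^ Suc N) * bsum q (Suc N) w =
    bsum q N (\<lambda>m. w (m + 1)) + bsum q N (\<lambda>m. q powi m * w m)"
proof -
  have nz: "qpoch q q n \<noteq> 0" for n
    using qpoch_nonzero[OF q q] .
  define c where "c = (\<lambda>m. w (int m) / (qpoch q q m * qpoch q q (Suc N - m)))"
  have "(1 - q ^ Suc N) * bsum q (Suc N) w = (\<Sum>m\<le>Suc N. (1 - q ^ Suc N) * c m)"
    by (simp only: bsum_def c_def sum_distrib_left)
  also have "\<dots> = (\<Sum>m\<le>Suc N. (1 - q ^ m) * c m + q ^ m * (1 - q ^ (Suc N - m)) * c m)"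
  proof (rule sum.cong[OF refl])
    fix m assume "m \<in> {..Suc N}"
    then have "q ^ Suc N = q ^ m * q ^ (Suc N - m)"
      by (simp flip: power_add)
    then show "(1 - q ^ Suc N) * c m = (1 - q ^ m) * c m + q ^ m * (1 - q ^ (Suc N - m)) * c m"
      by (simp only:) (simp add: algebra_simps)
  qed
  also have "\<dots> = (\<Sum>m\<le>Suc N. (1 - q ^ m) * c m) + (\<Sum>m\<le>Suc N. q ^ m * (1 - q ^ (Suc N - m)) * c m)"
    by (rule sum.distrib)
  also have "(\<Sum>m\<le>Suc N. (1 - q ^ m) * c m) = (\<Sum>m\<le>N. (1 - q ^ Suc m) * c (Suc m))"
    by (subst sum.atMost_Suc_shift) simp
  also have "\<dots> = bsum q N (\<lambda>m. w (m + 1))"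
    unfolding bsum_def
  proof (rule sum.cong[OF refl])
    fix m
    show "(1 - q ^ Suc m) * c (Suc m) = w (int m + 1) / (qpoch q q m * qpoch q q (N - m))"
      using nz[of "Suc m"] nz[of m] by (simp add: c_def qpoch_Suc add.commute)
  qed
  also have "(\<Sum>m\<le>Suc N. q ^ m * (1 - q ^ (Suc N - m)) * c m) =
      (\<Sum>m\<le>N. q ^ m * (1 - q ^ (Suc N - m)) * c m)"
    by simp
  also have "\<dots> = bsum q N (\<lambda>m. q powi m * w m)"
    unfolding bsum_def
  proof (rule sum.cong[OF refl])
    fix m assume "m \<in> {..N}"
    then have "Suc N - m = Suc (N - m)" by auto
    then show "q ^ m * (1 - q ^ (Suc N - m)) * c m =
      q powi int m * w (int m) / (qpoch q q m * qpoch q q (N - m))"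
      using nz[of "Suc (N - m)"] nz[of "N - m"] by (simp add: c_def qpoch_Suc)
  qed
  finally show ?thesis .
qed

text \<open>The companion recurrence, obtained by conjugating the first one with the reflection of
  m.\<close>

lemma bsum_pascal':
  assumes q: "norm q < 1"
  shows "(1 - q ^ Suc N) * bsum q (Suc N) w =
    bsum q N w + bsum q N (\<lambda>m. q powi (int N - m) * w (m + 1))"
proof -
  have "(1 - q ^ Suc N) * bsum q (Suc N) w =
    bsum q N (\<lambda>m. w (int N - m)) + bsum q N (\<lambda>m. q powi m * w (int N + 1 - m))"
    by (subst bsum_reflect, subst bsum_pascal[OF q]) (simp add: algebra_simps)
  also have "bsum q N (\<lambda>m. w (int N - m)) = bsum q N w"
    by (rule bsum_reflect[symmetric])
  also have "bsum q N (\<lambda>m. q powi m * w (int N + 1 - m)) = bsum q N (\<lambda>m. q powi (int N - m) * w (m + 1))"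
    by (subst bsum_reflect) (simp add: algebra_simps)
  finally show ?thesis .
qed

text \<open>The weights of the Bailey pairs for base \<open>q\<close>.\<close>

definition vw :: "complex \<Rightarrow> int \<Rightarrow> int \<Rightarrow> complex" where
  "vw q c j = (if even j then (- 1) powi (j div 2) * q powi ((j div 2)\<^sup>2 + c * (j div 2)) else 0)"

lemma vw_even: "vw q c (2 * k) = (- 1) powi k * q powi (k\<^sup>2 + c * k)"
  by (simp add: vw_def)

lemma vw_odd: "odd j \<Longrightarrow> vw q c j = 0"
  by (simp add: vw_def)

lemma vw_minus: "vw q c (- j) = vw q (- c) j"
proof (cases "even j")
  case True
  then obtain k where k: "j = 2 * k" by blast
  then show ?thesis
    using vw_even[of q c "- k"] vw_even[of q "- c" k] by (simp add: power_int_minus_one_minus)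
qed (simp add: vw_odd)

lemma vw_shift:
  assumes "q \<noteq> 0"
  shows "vw q c j = - (q powi (1 + c)) * vw q (c + 2) (j - 2)"
proof (cases "even j")
  case True
  then obtain k where k: "j = 2 * k" by blast
  have "k\<^sup>2 + c * k = (1 + c) + ((k - 1)\<^sup>2 + (c + 2) * (k - 1))"
    by (simp add: power2_eq_square algebra_simps)
  then have "q powi (k\<^sup>2 + c * k) = q powi (1 + c) * q powi ((k - 1)\<^sup>2 + (c + 2) * (k - 1))"
    using assms by (simp only: powi_add simp_thms)
  then show ?thesis
    using vw_even[of q c k] vw_even[of q "c + 2" "k - 1"]
    by (simp add: k algebra_simps power_int_diff)
qed (simp add: vw_odd)

lemma vw_mult:
  assumes "q \<noteq> 0"
  shows "q powi j * vw q c j = vw q (c + 2) j"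
proof (cases "even j")
  case True
  then obtain k where k: "j = 2 * k" by blast
  have "2 * k + (k\<^sup>2 + c * k) = k\<^sup>2 + (c + 2) * k"
    by (simp add: algebra_simps)
  then have "q powi (2 * k) * q powi (k\<^sup>2 + c * k) = q powi (k\<^sup>2 + (c + 2) * k)"
    using assms by (metis powi_add)
  then show ?thesis
    unfolding k vw_even by simp
qed (simp add: vw_odd)

text \<open>The centre a and the linear coefficient c suffice as parameters: translation by 2 and
  multiplication by q^j each change c by 2, so both Pascal recurrences stay within this
  family.\<close>

definition vsum :: "complex \<Rightarrow> nat \<Rightarrow> int \<Rightarrow> int \<Rightarrow> complex" where
  "vsum q N a c = bsum q N (\<lambda>m. vw q c (m - a))"

lemma vsum_reflect: "vsum q N a c = vsum q N (int N - a) (- c)"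
proof -
  have "vsum q N a c = bsum q N (\<lambda>m. vw q c (int N - m - a))"
    unfolding vsum_def by (rule bsum_reflect)
  also have "\<dots> = vsum q N (int N - a) (- c)"
    unfolding vsum_def vw_minus[symmetric] by (simp add: algebra_simps)
  finally show ?thesis .
qed

lemma vsum_shift:
  assumes "q \<noteq> 0"
  shows "vsum q N a c = - (q powi (1 + c)) * vsum q N (a + 2) (c + 2)"
  unfolding vsum_def bsum_cmult[symmetric]
  by (rule bsum_cong) (subst vw_shift[OF assms], simp add: algebra_simps)

lemma vsum_pascal:
  assumes "norm q < 1" "q \<noteq> 0"
  shows "(1 - q ^ Suc N) * vsum q (Suc N) a c = vsum q N (a - 1) c + q powi a * vsum q N a (c + 2)"
proof -
  have "q powi m * vw q c (m - a) = q powi a * vw q (c + 2) (m - a)" for m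
    using assms by (simp add: power_int_diff flip: vw_mult)
  then show ?thesis
    unfolding vsum_def bsum_pascal[OF assms(1)]
    by (simp add: bsum_cmult algebra_simps)
qed

lemma vsum_pascal':
  assumes "norm q < 1" "q \<noteq> 0"
  shows "(1 - q ^ Suc N) * vsum q (Suc N) a c =
    vsum q N a c + q powi (int N + 1 - a) * vsum q N (a - 1) (c - 2)"
proof -
  have "q powi (int N - m) * vw q c (m + 1 - a) = q powi (int N + 1 - a) * vw q (c - 2) (m - (a - 1))" for m
  proof -
    have "q powi (int N + 1 - a) = q powi (int N - m) * q powi (m - (a - 1))"
      using powi_add[OF assms(2), of "int N - m" "m - (a - 1)"] by (simp add: algebra_simps)
    moreover have "vw q c (m + 1 - a) = q powi (m - (a - 1)) * vw q (c - 2) (m - (a - 1))"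
      using vw_mult[OF assms(2), of "m - (a - 1)" "c - 2"] by (simp add: algebra_simps)
    ultimately show ?thesis by simp
  qed
  then show ?thesis
    unfolding vsum_def bsum_pascal'[OF assms(1)]
    by (simp add: bsum_cmult)
qed

text \<open>At c = -1 the shift factor is exactly -1, so the two sums are negatives of each other;
  reflection makes them equal.\<close>

lemma vsum_eq_0:
  assumes "q \<noteq> 0"
  shows "vsum q (2 * n) (int n - 1) (- 1) = 0" "vsum q (2 * n) (int n + 1) 1 = 0"
proof -
  have "vsum q (2 * n) (int n - 1) (- 1) = - vsum q (2 * n) (int n + 1) 1"
    using vsum_shift[OF assms, of "2 * n" "int n - 1" "- 1"] by (simp add: add.commute)
  moreover have "vsum q (2 * n) (int n + 1) 1 = vsum q (2 * n) (int n - 1) (- 1)"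
    using vsum_reflect[of q "2 * n" "int n + 1" 1] by simp
  ultimately show "vsum q (2 * n) (int n - 1) (- 1) = 0" "vsum q (2 * n) (int n + 1) 1 = 0"
    by simp_all
qed

text \<open>In both cases one of the two terms of the Pascal recurrence is a vanishing sum.
  Reflection first brings the sum with c = 1 to c = -1.\<close>

lemma vsum_odd:
  assumes "norm q < 1" "q \<noteq> 0"
  shows "(1 - q ^ (2 * n + 1)) * vsum q (2 * n + 1) (int n + 1) 1 = q ^ n * vsum q (2 * n) (int n) 1"
    and "(1 - q ^ (2 * n + 1)) * vsum q (2 * n + 1) (int n + 1) (- 1) = vsum q (2 * n) (int n) 1"
proof -
  have "vsum q (2 * n + 1) (int n + 1) 1 = vsum q (2 * n + 1) (int n) (- 1)"
    using vsum_reflect[of q "2 * n + 1" "int n + 1" 1] by simp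
  then show "(1 - q ^ (2 * n + 1)) * vsum q (2 * n + 1) (int n + 1) 1 = q ^ n * vsum q (2 * n) (int n) 1"
    using vsum_pascal[OF assms, of "2 * n" "int n" "- 1"] vsum_eq_0[OF assms(2), of n] by simp
  have "vsum q (2 * n) (int n) (- 1) = vsum q (2 * n) (int n) 1"
    using vsum_reflect[of q "2 * n" "int n" 1] by simp
  then show "(1 - q ^ (2 * n + 1)) * vsum q (2 * n + 1) (int n + 1) (- 1) = vsum q (2 * n) (int n) 1"
    using vsum_pascal[OF assms, of "2 * n" "int n + 1" "- 1"] vsum_eq_0[OF assms(2), of n] by simp
qed

text \<open>Here neither term vanishes. Reflection makes the two sums equal, which produces the
  factor 1 + q^(n+1) and in the end (-q;q)_n.\<close>

lemma vsum_Suc: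
  assumes "norm q < 1" "q \<noteq> 0"
  shows "(1 - q ^ (2 * n + 2)) * vsum q (2 * n + 2) (int n + 1) 1 =
    (1 + q ^ Suc n) * vsum q (2 * n + 1) (int n + 1) 1"
proof -
  have "vsum q (2 * n + 1) (int n + 1) 1 = vsum q (2 * n + 1) (int n) (- 1)"
    using vsum_reflect[of q "2 * n + 1" "int n + 1" 1] by simp
  moreover have "q powi (int (2 * n + 1) + 1 - (int n + 1)) = q ^ Suc n"
    by (subst power_int_of_nat[symmetric]) (simp add: algebra_simps)
  ultimately show ?thesis
    using vsum_pascal'[OF assms, of "2 * n + 1" "int n + 1" 1] by (simp add: algebra_simps)
qed

lemma vsum_closed_even:
  assumes q: "norm q < 1" "q \<noteq> 0"
  shows "vsum q (2 * n) (int n) 1 = q ^ (n choose 2) * qpoch (- q) q n / qpoch q q (2 * n)"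
proof (induction n)
  case 0
  show ?case
    by (simp add: vsum_def bsum_def vw_def numeral_2_eq_2)
next
  case (Suc n)
  have nz: "qpoch q q m \<noteq> 0" for m
    using qpoch_nonzero[OF q(1) q(1)] .
  have nz': "1 - q ^ Suc m \<noteq> 0" for m
    using nz[of "Suc m"] by (simp add: qpoch_Suc)
  have "vsum q (2 * Suc n) (int (Suc n)) 1 =
    (1 + q ^ Suc n) * (q ^ n * vsum q (2 * n) (int n) 1) / ((1 - q ^ (2 * n + 1)) * (1 - q ^ (2 * n + 2)))"
    using eq_divide_two_steps[OF vsum_Suc[OF q, of n] vsum_odd(1)[OF q, of n]] nz'[of "2 * n"] nz'[of "2 * n + 1"]
    by (simp add: add.commute)
  then show ?case
    unfolding Suc.IH using nz[of "2 * n"] nz[of "2 * n + 1"] nz[of "2 * n + 2"]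
    by (simp add: qpoch_Suc numeral_2_eq_2 power_add field_simps)
qed

lemma vsum_closed_odd:
  assumes q: "norm q < 1" "q \<noteq> 0"
  shows "vsum q (2 * n + 1) (int n + 1) 1 = q ^ (Suc n choose 2) * qpoch (- q) q n / qpoch q q (2 * n + 1)"
    and "vsum q (2 * n + 1) (int n + 1) (- 1) = q ^ (n choose 2) * qpoch (- q) q n / qpoch q q (2 * n + 1)"
  using vsum_odd[OF q, of n] qpoch_nonzero[OF q(1) q(1), of "2 * n"] qpoch_nonzero[OF q(1) q(1), of "2 * n + 1"]
  unfolding vsum_closed_even[OF q]
  by (simp_all add: qpoch_Suc numeral_2_eq_2 power_add field_simps)

text \<open>The weights of the Bailey pairs for base \<open>p\<^sup>2\<close>. Only odd \<open>c\<close> is meant, where the division is exact.\<close>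

definition uw :: "complex \<Rightarrow> int \<Rightarrow> int \<Rightarrow> complex" where
  "uw p c j = (- 1) powi j * p powi ((j\<^sup>2 + c * j) div 2)"

lemma uw_minus: "uw p c (- j) = uw p (- c) j"
  by (simp add: uw_def power_int_minus_one_minus)

lemma uw_shift:
  assumes "p \<noteq> 0" "odd c"
  shows "uw p c j = - (p powi ((1 + c) div 2)) * uw p (c + 2) (j - 1)"
proof -
  have "j\<^sup>2 + c * j = (1 + c) + ((j - 1)\<^sup>2 + (c + 2) * (j - 1))"
    by (simp add: power2_eq_square algebra_simps)
  moreover have "even (1 + c)" using assms by simp
  ultimately have "(j\<^sup>2 + c * j) div 2 = (1 + c) div 2 + ((j - 1)\<^sup>2 + (c + 2) * (j - 1)) div 2"
    by (simp only: div_plus_div_distrib_dvd_left)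
  then have "p powi ((j\<^sup>2 + c * j) div 2) =
    p powi ((1 + c) div 2) * p powi (((j - 1)\<^sup>2 + (c + 2) * (j - 1)) div 2)"
    using assms(1) by (simp only: powi_add simp_thms)
  then show ?thesis
    by (simp add: uw_def power_int_diff)
qed

lemma uw_mult:
  assumes "p \<noteq> 0"
  shows "(p\<^sup>2) powi j * uw p c j = uw p (c + 4) j"
proof -
  have "j\<^sup>2 + (c + 4) * j = (2 * j) * 2 + (j\<^sup>2 + c * j)"
    by (simp add: algebra_simps)
  then have "(j\<^sup>2 + (c + 4) * j) div 2 = 2 * j + (j\<^sup>2 + c * j) div 2"
    by (simp only: div_mult_self3)
  then have "p powi ((j\<^sup>2 + (c + 4) * j) div 2) = p powi (2 * j) * p powi ((j\<^sup>2 + c * j) div 2)"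
    using assms by (simp only: powi_add simp_thms)
  moreover have "(p\<^sup>2) powi j = p powi (2 * j)"
    by (simp add: power_int_mult)
  ultimately show ?thesis
    by (simp add: uw_def)
qed

text \<open>The denominators have base p^2 while the weights use single powers of p, that is,
  half-integral powers of the base. Multiplying by (p^2)^j therefore moves c by 4, and translation
  by 1 moves it by 2.\<close>

definition usum :: "complex \<Rightarrow> nat \<Rightarrow> int \<Rightarrow> int \<Rightarrow> complex" where
  "usum p N a c = bsum (p\<^sup>2) N (\<lambda>m. uw p c (m - a))"

lemma usum_reflect: "usum p N a c = usum p N (int N - a) (- c)"
proof -
  have "usum p N a c = bsum (p\<^sup>2) N (\<lambda>m. uw p c (int N - m - a))"
    unfolding usum_def by (rule bsum_reflect)
  also have "\<dots> = usum p N (int N - a) (- c)"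
    unfolding usum_def uw_minus[symmetric] by (simp add: algebra_simps)
  finally show ?thesis .
qed

lemma usum_shift:
  assumes "p \<noteq> 0" "odd c"
  shows "usum p N a c = - (p powi ((1 + c) div 2)) * usum p N (a + 1) (c + 2)"
  unfolding usum_def bsum_cmult[symmetric]
  by (rule bsum_cong) (subst uw_shift[OF assms], simp add: algebra_simps)

lemma usum_pascal:
  assumes "norm p < 1" "p \<noteq> 0"
  shows "(1 - (p\<^sup>2) ^ Suc N) * usum p (Suc N) a c =
    usum p N (a - 1) c + (p\<^sup>2) powi a * usum p N a (c + 4)"
proof -
  have "(p\<^sup>2) powi m * uw p c (m - a) = (p\<^sup>2) powi a * uw p (c + 4) (m - a)" for m
    using assms by (simp add: power_int_diff flip: uw_mult)
  then show ?thesis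
    unfolding usum_def bsum_pascal[OF norm_power_lt_1[OF assms(1) pos2]]
    by (simp add: bsum_cmult algebra_simps)
qed

lemma usum_pascal':
  assumes "norm p < 1" "p \<noteq> 0"
  shows "(1 - (p\<^sup>2) ^ Suc N) * usum p (Suc N) a c =
    usum p N a c + (p\<^sup>2) powi (int N + 1 - a) * usum p N (a - 1) (c - 4)"
proof -
  have "(p\<^sup>2) powi (int N - m) * uw p c (m + 1 - a) =
    (p\<^sup>2) powi (int N + 1 - a) * uw p (c - 4) (m - (a - 1))" for m
  proof -
    have "(p\<^sup>2) powi (int N + 1 - a) = (p\<^sup>2) powi (int N - m) * (p\<^sup>2) powi (m - (a - 1))"
      using assms powi_add[of "p\<^sup>2" "int N - m" "m - (a - 1)"] by (simp add: algebra_simps)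
    moreover have "uw p c (m + 1 - a) = (p\<^sup>2) powi (m - (a - 1)) * uw p (c - 4) (m - (a - 1))"
      using uw_mult[OF assms(2), of "m - (a - 1)" "c - 4"] by (simp add: algebra_simps)
    ultimately show ?thesis by simp
  qed
  then show ?thesis
    unfolding usum_def bsum_pascal'[OF norm_power_lt_1[OF assms(1) pos2]]
    by (simp add: bsum_cmult)
qed

text \<open>The same sign clash between shift and reflection as for \<open>vsum\<close>, now at odd
  length.\<close>

lemma usum_eq_0:
  assumes "p \<noteq> 0"
  shows "usum p (2 * n + 1) (int n + 1) 1 = 0" "usum p (2 * n + 1) (int n) (- 1) = 0"
proof -
  have "usum p (2 * n + 1) (int n) (- 1) = - usum p (2 * n + 1) (int n + 1) 1"
    using usum_shift[OF assms, of "- 1" "2 * n + 1" "int n"] by simp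
  moreover have "usum p (2 * n + 1) (int n + 1) 1 = usum p (2 * n + 1) (int n) (- 1)"
    using usum_reflect[of p "2 * n + 1" "int n + 1" 1] by simp
  ultimately show "usum p (2 * n + 1) (int n + 1) 1 = 0" "usum p (2 * n + 1) (int n) (- 1) = 0"
    by simp_all
qed

text \<open>Both Pascal terms are multiples of the central sum: the first by reflection, the second
  by a shift from c = 1 to c = 3, which supplies -p^(2n+1).\<close>

lemma usum_odd:
  assumes "norm p < 1" "p \<noteq> 0"
  shows "(1 - (p\<^sup>2) ^ (2 * n + 1)) * usum p (2 * n + 1) (int n + 1) (- 1) =
    (1 - p ^ (2 * n + 1)) * usum p (2 * n) (int n) 1"
proof -
  have "usum p (2 * n) (int n) (- 1) = usum p (2 * n) (int n) 1"
    using usum_reflect[of p "2 * n" "int n" 1] by simp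
  moreover have "usum p (2 * n) (int n) 1 = - p * usum p (2 * n) (int n + 1) 3"
    using usum_shift[OF assms(2), of 1 "2 * n" "int n"] by simp
  moreover have "(p\<^sup>2) powi (int n + 1) = p ^ (2 * n + 2)"
  proof -
    have "(p\<^sup>2) powi (int n + 1) = (p\<^sup>2) ^ Suc n"
      by (subst power_int_of_nat[symmetric]) (simp add: add.commute)
    then show ?thesis by (simp only: power_mult[symmetric]) simp
  qed
  ultimately show ?thesis
    using usum_pascal[OF assms, of "2 * n" "int n + 1" "- 1"] by (simp add: algebra_simps power2_eq_square)
qed

text \<open>For c = 1 the first Pascal term vanishes and for c = 3 the second. The survivor is in
  both cases the sum with c = -3, up to a reflection, and one shift takes it to c = -1.\<close>

lemma usum_Suc:
  assumes "norm p < 1" "p \<noteq> 0"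
  shows "(1 - (p\<^sup>2) ^ (2 * n + 2)) * usum p (2 * n + 2) (int n + 1) 1 =
      - (p ^ (2 * n + 1)) * usum p (2 * n + 1) (int n + 1) (- 1)"
    and "(1 - (p\<^sup>2) ^ (2 * n + 2)) * usum p (2 * n + 2) (int n + 1) 3 =
      - (1 / p) * usum p (2 * n + 1) (int n + 1) (- 1)"
proof -
  have *: "usum p (2 * n + 1) (int n) (- 3) = - (1 / p) * usum p (2 * n + 1) (int n + 1) (- 1)"
    using usum_shift[OF assms(2), of "- 3" "2 * n + 1" "int n"] by (simp add: power_int_minus divide_inverse)
  have "(p\<^sup>2) powi (int (2 * n + 1) + 1 - (int n + 1)) = (p\<^sup>2) ^ Suc n"
    by (subst power_int_of_nat[symmetric]) (simp add: algebra_simps)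
  then show "(1 - (p\<^sup>2) ^ (2 * n + 2)) * usum p (2 * n + 2) (int n + 1) 1 =
      - (p ^ (2 * n + 1)) * usum p (2 * n + 1) (int n + 1) (- 1)"
    using usum_pascal'[OF assms, of "2 * n + 1" "int n + 1" 1] usum_eq_0[OF assms(2), of n] * assms
    by (simp add: power_mult power2_eq_square)
  have "usum p (2 * n + 1) (int n + 1) 3 = usum p (2 * n + 1) (int n) (- 3)"
    using usum_reflect[of p "2 * n + 1" "int n + 1" 3] by simp
  then show "(1 - (p\<^sup>2) ^ (2 * n + 2)) * usum p (2 * n + 2) (int n + 1) 3 =
      - (1 / p) * usum p (2 * n + 1) (int n + 1) (- 1)"
    using usum_pascal'[OF assms, of "2 * n + 1" "int n + 1" 3] usum_eq_0[OF assms(2), of n] *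
    by simp
qed

text \<open>Two recurrence steps contribute -p^(2n+1) (1 - p^(2n+1)). The odd exponents add up to
  n^2 and the brackets build (p;p^2)_n.\<close>

lemma usum_closed:
  assumes p: "norm p < 1" "p \<noteq> 0"
  shows "usum p (2 * n) (int n) 1 = (- 1) ^ n * p ^ n\<^sup>2 * qpoch p (p\<^sup>2) n / qpoch (p\<^sup>2) (p\<^sup>2) (2 * n)"
proof (induction n)
  case 0
  show ?case
    by (simp add: usum_def bsum_def uw_def)
next
  case (Suc n)
  have p2: "norm (p\<^sup>2) < 1" using norm_power_lt_1[OF p(1)] by simp
  have nz: "qpoch (p\<^sup>2) (p\<^sup>2) m \<noteq> 0" for m
    using qpoch_nonzero[OF p2 p2] .
  have nz': "1 - (p\<^sup>2) ^ Suc m \<noteq> 0" for m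
    using nz[of "Suc m"] by (simp add: qpoch_Suc)
  have "usum p (2 * Suc n) (int (Suc n)) 1 =
    - (p ^ (2 * n + 1)) * ((1 - p ^ (2 * n + 1)) * usum p (2 * n) (int n) 1) /
      ((1 - (p\<^sup>2) ^ (2 * n + 1)) * (1 - (p\<^sup>2) ^ (2 * n + 2)))"
    using eq_divide_two_steps[OF usum_Suc(1)[OF p, of n] usum_odd[OF p, of n]] nz'[of "2 * n"] nz'[of "2 * n + 1"]
    by (simp add: add.commute)
  moreover have "qpoch (p\<^sup>2) (p\<^sup>2) (2 * Suc n) =
    qpoch (p\<^sup>2) (p\<^sup>2) (2 * n) * ((1 - (p\<^sup>2) ^ (2 * n + 1)) * (1 - (p\<^sup>2) ^ (2 * n + 2)))"
    by (simp add: qpoch_Suc)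
  moreover have "p ^ (Suc n)\<^sup>2 = p ^ n\<^sup>2 * p ^ (2 * n + 1)"
  proof -
    have "(Suc n)\<^sup>2 = n\<^sup>2 + (2 * n + 1)"
      by (simp add: power2_eq_square)
    then show ?thesis by (simp only: power_add)
  qed
  moreover have "qpoch p (p\<^sup>2) (Suc n) = qpoch p (p\<^sup>2) n * (1 - p ^ (2 * n + 1))"
    by (simp add: qpoch_Suc power_mult)
  ultimately show ?case
    unfolding Suc.IH by simp
qed

text \<open>The two recurrences in \<open>usum_Suc\<close> have right-hand sides whose ratio is
  p^(2n+2). They only reach positive lengths, hence the separate case n = 0.\<close>

lemma usum_closed':
  assumes p: "norm p < 1" "p \<noteq> 0"
  shows "p ^ (2 * n) * usum p (2 * n) (int n) 3 = usum p (2 * n) (int n) 1"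
proof (cases n)
  case 0
  then show ?thesis
    by (simp add: usum_def bsum_def uw_def)
next
  case (Suc m)
  have p2: "norm (p\<^sup>2) < 1" using norm_power_lt_1[OF p(1)] by simp
  have "1 - (p\<^sup>2) ^ (2 * m + 2) \<noteq> 0"
    using qpoch_nonzero[OF p2 p2, of "2 * m + 2"] by (simp add: qpoch_Suc)
  moreover have "(1 - (p\<^sup>2) ^ (2 * m + 2)) * (p ^ (2 * m + 2) * usum p (2 * m + 2) (int m + 1) 3) =
    (1 - (p\<^sup>2) ^ (2 * m + 2)) * usum p (2 * m + 2) (int m + 1) 1"
    unfolding usum_Suc(1)[OF p] mult.left_commute[of _ "p ^ (2 * m + 2)"] usum_Suc(2)[OF p]
    using p by (simp add: power_add)
  ultimately have "p ^ (2 * m + 2) * usum p (2 * m + 2) (int m + 1) 3 = usum p (2 * m + 2) (int m + 1) 1"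
    by (simp only: mult_cancel_left simp_thms)
  then show ?thesis by (simp add: Suc add.commute)
qed

section \<open>Single and double sums\<close>

lemma powi_power: "(q ^ n) powi e = (q :: complex) powi (int n * e)"
  by (simp add: power_int_mult)

lemma two_times_div_two: "even (m :: int) \<Longrightarrow> 2 * (m div 2) = m"
  by simp

text \<open>Only j = 2k contributes, with total exponent 5 k^2 + (c + 2e) k. This is a Jacobi theta
  series of base q^10 at z = q^(5+c+2e).\<close>

lemma has_sum_vw:
  assumes q: "norm q < 1" "q \<noteq> 0"
  shows "((\<lambda>j. vw q c j * q powi (j\<^sup>2 + e * j)) has_sum
    qpoch_inf (q powi (5 + c + 2 * e)) (q ^ 10) * qpoch_inf (q powi (5 - c - 2 * e)) (q ^ 10) *
      qpoch_inf (q ^ 10) (q ^ 10)) UNIV"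
proof -
  define z where "z = q powi (5 + c + 2 * e)"
  have z: "z \<noteq> 0" using q by (simp add: z_def)
  have "q ^ 10 / z = q powi (10 - (5 + c + 2 * e))"
    using power_int_diff[of q 10 "5 + c + 2 * e"] q by (simp add: z_def)
  then have qz: "q ^ 10 / z = q powi (5 - c - 2 * e)" by (simp add: algebra_simps)
  have summand: "(- z) powi k * (q ^ 10) powi ((k\<^sup>2 - k) div 2) =
    vw q c (2 * k) * q powi ((2 * k)\<^sup>2 + e * (2 * k))" for k
  proof -
    have "even (k\<^sup>2 - k)"
      by simp
    then obtain x where x: "k\<^sup>2 - k = 2 * x"
      by (blast elim: evenE)
    have "(5 + c + 2 * e) * k + 5 * (k\<^sup>2 - k) = (k\<^sup>2 + c * k) + ((2 * k)\<^sup>2 + e * (2 * k))"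
      by (simp add: power2_eq_square algebra_simps)
    then have "(5 + c + 2 * e) * k + 10 * ((k\<^sup>2 - k) div 2) =
      (k\<^sup>2 + c * k) + ((2 * k)\<^sup>2 + e * (2 * k))"
      by (simp only: x) simp
    then have "q powi ((5 + c + 2 * e) * k) * q powi (10 * ((k\<^sup>2 - k) div 2)) =
      q powi (k\<^sup>2 + c * k) * q powi ((2 * k)\<^sup>2 + e * (2 * k))"
      using q(2) by (metis powi_add)
    moreover have "(- z) powi k = (- 1) powi k * q powi ((5 + c + 2 * e) * k)"
      using power_int_mult_distrib[of "- 1" z k] by (simp add: z_def power_int_mult)
    ultimately show ?thesis
      by (simp add: vw_even powi_power mult.assoc)
  qed
  have "((\<lambda>j. vw q c j * q powi (j\<^sup>2 + e * j)) has_sum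
    qpoch_inf z (q ^ 10) * qpoch_inf (q ^ 10 / z) (q ^ 10) * qpoch_inf (q ^ 10) (q ^ 10)) (range ((*) 2))"
    using jacobi_triple[OF norm_power_lt_1[OF q(1), of 10] _ z] q
    by (subst has_sum_reindex) (auto simp: o_def summand inj_on_def)
  also have "?this \<longleftrightarrow> ((\<lambda>j. vw q c j * q powi (j\<^sup>2 + e * j)) has_sum
    qpoch_inf z (q ^ 10) * qpoch_inf (q ^ 10 / z) (q ^ 10) * qpoch_inf (q ^ 10) (q ^ 10)) UNIV"
  proof (rule has_sum_cong_neutral)
    fix j :: int
    assume "j \<in> UNIV - range ((*) 2)"
    then have "odd j" by (auto elim: evenE)
    then show "vw q c j * q powi (j\<^sup>2 + e * j) = 0"
      by (simp add: vw_odd)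
  qed auto
  finally show ?thesis
    by (simp only: qz z_def[symmetric])
qed

text \<open>The total exponent (5 j^2 + c j)/2 gives a Jacobi theta series of base p^5 at z =
  p^((5+c)/2).\<close>

lemma has_sum_uw:
  assumes p: "norm p < 1" "p \<noteq> 0" and c: "odd c"
  shows "((\<lambda>j. uw p c j * (p\<^sup>2) powi (j\<^sup>2)) has_sum
    qpoch_inf (p powi ((5 + c) div 2)) (p ^ 5) * qpoch_inf (p powi ((5 - c) div 2)) (p ^ 5) *
      qpoch_inf (p ^ 5) (p ^ 5)) UNIV"
proof -
  define d where "d = (5 + c) div 2"
  have d: "2 * d = 5 + c" unfolding d_def by (rule two_times_div_two) (use c in simp)
  have d': "(5 - c) div 2 = 5 - d" using d by linarith
  define z where "z = p powi d"
  have z: "z \<noteq> 0" using p by (simp add: z_def)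
  have pz: "p ^ 5 / z = p powi (5 - d)"
    using power_int_diff[of p 5 d] p by (simp add: z_def)
  have "(- z) powi k * (p ^ 5) powi ((k\<^sup>2 - k) div 2) = uw p c k * (p\<^sup>2) powi (k\<^sup>2)" for k
  proof -
    have "even (k\<^sup>2 - k)" "even (k\<^sup>2 + c * k)"
      using c by auto
    then obtain x y where xy: "k\<^sup>2 - k = 2 * x" "k\<^sup>2 + c * k = 2 * y"
      by (blast elim: evenE)
    moreover have "2 * (d * k) = 5 * k + c * k"
      using arg_cong[OF d, of "\<lambda>x. x * k"] by (simp add: algebra_simps)
    ultimately have "d * k + 5 * x = y + 2 * k\<^sup>2"
      by linarith
    then have "d * k + 5 * ((k\<^sup>2 - k) div 2) = (k\<^sup>2 + c * k) div 2 + 2 * k\<^sup>2"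
      by (simp add: xy)
    then have "p powi (d * k) * p powi (5 * ((k\<^sup>2 - k) div 2)) =
      p powi ((k\<^sup>2 + c * k) div 2) * p powi (2 * k\<^sup>2)"
      using p(2) by (metis powi_add)
    moreover have "(- z) powi k = (- 1) powi k * p powi (d * k)"
      using power_int_mult_distrib[of "- 1" z k] by (simp add: z_def power_int_mult)
    ultimately show ?thesis
      by (simp add: uw_def powi_power mult.assoc)
  qed
  then show ?thesis
    using jacobi_triple[OF norm_power_lt_1[OF p(1), of 5] _ z] p
    unfolding d' d_def[symmetric] by (simp flip: pz z_def)
qed

lemma norm_powi_le:
  assumes "norm (q :: complex) < 1" "q \<noteq> 0" "m \<le> n"
  shows "norm (q powi n) \<le> norm q powi m"
  using assms by (simp add: norm_power_int power_int_decreasing)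

text \<open>Supplies the uniform bound on the weights that Bailey's lemma demands. The crude -c^2
  keeps the bound integral.\<close>

lemma square_plus_linear_ge: "- (c\<^sup>2) \<le> k\<^sup>2 + c * k" for c k :: int
proof -
  have "4 * (k\<^sup>2 + c * k + c\<^sup>2) = (2 * k + c)\<^sup>2 + 3 * c\<^sup>2"
    by (simp add: power2_eq_square algebra_simps)
  then have "0 \<le> 4 * (k\<^sup>2 + c * k + c\<^sup>2)"
    by (simp only:) simp
  then show ?thesis by simp
qed

lemma norm_vw_le:
  assumes "norm q < 1" "q \<noteq> 0"
  shows "norm (vw q c j) \<le> norm q powi (- (c\<^sup>2))"
  using norm_powi_le[OF assms square_plus_linear_ge[of c "j div 2"]]
  by (auto simp: vw_def norm_mult norm_power_int)

lemma norm_uw_le: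
  assumes "norm p < 1" "p \<noteq> 0"
  shows "norm (uw p c j) \<le> norm p powi (- (c\<^sup>2))"
proof -
  have "- (c\<^sup>2) \<le> (j\<^sup>2 + c * j) div 2"
    using square_plus_linear_ge[of c j] zero_le_power2[of c] by linarith
  from norm_powi_le[OF assms this] show ?thesis
    by (simp add: uw_def norm_mult norm_power_int)
qed

lemma has_sum_vsum:
  assumes q: "norm q < 1" "q \<noteq> 0" and E: "E \<le> 1"
  shows "((\<lambda>n. q ^ (n\<^sup>2 + E * n) * vsum q (2 * n + E) (int n + int E) c) has_sum
    qpoch_inf (q powi (5 + c + 2 * int E)) (q ^ 10) * qpoch_inf (q powi (5 - c - 2 * int E)) (q ^ 10) *
      qpoch_inf (q ^ 10) (q ^ 10) / qpoch_inf q q) UNIV"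
  using has_sum_bailey[OF q E norm_vw_le[OF q] has_sum_vw[OF q]]
  by (simp add: vsum_def bsum_def diff_diff_eq)

lemma has_sum_usum:
  assumes p: "norm p < 1" "p \<noteq> 0" and c: "odd c"
  shows "((\<lambda>n. (p\<^sup>2) ^ n\<^sup>2 * usum p (2 * n) (int n) c) has_sum
    qpoch_inf (p powi ((5 + c) div 2)) (p ^ 5) * qpoch_inf (p powi ((5 - c) div 2)) (p ^ 5) *
      qpoch_inf (p ^ 5) (p ^ 5) / qpoch_inf (p\<^sup>2) (p\<^sup>2)) UNIV"
  using has_sum_bailey[OF norm_power_lt_1[OF p(1) pos2] _ _ norm_uw_le[OF p], of 0] has_sum_uw[OF p c] p(2)
  by (simp add: usum_def bsum_def)

text \<open>The inner sum over j is Euler's, and the shift formula splits its value into the fixed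
  product (-x;b)_inf and a finite part that \<open>g\<close> absorbs.\<close>

lemma has_sum_double:
  assumes b: "norm b < 1" "b \<noteq> 0" and x: "x \<noteq> 0"
    and f: "\<And>i j. f (i, j) = h i * (b ^ (j choose 2) / qpoch b b j * (x / b ^ i) ^ j)"
    and summable: "f summable_on UNIV"
    and g: "\<And>i. h i * (x ^ i / b ^ (Suc i choose 2) * qpoch (- (b / x)) b i) = g i"
    and G: "(g has_sum G) UNIV"
  shows "(f has_sum (G * qpoch_inf (- x) b)) (UNIV :: (nat \<times> nat) set)"
  unfolding UNIV_Times_UNIV[symmetric]
proof (rule has_sum_SigmaI)
  fix i
  have "((\<lambda>j. f (i, j)) has_sum h i * qpoch_inf (- (x / b ^ i)) b) UNIV"
    unfolding f by (intro has_sum_cmult_right has_sum_euler b)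
  then show "((\<lambda>j. f (i, j)) has_sum g i * qpoch_inf (- x) b) UNIV"
    unfolding qpoch_inf_shift[OF b x] g[symmetric] by (simp add: mult.assoc)
next
  show "((\<lambda>i. g i * qpoch_inf (- x) b) has_sum G * qpoch_inf (- x) b) UNIV"
    by (rule has_sum_cmult_left[OF G])
qed (use summable in simp)

lemma summable_on_double:
  fixes e :: "nat \<Rightarrow> nat \<Rightarrow> int" and M :: "nat \<Rightarrow> nat"
  assumes q: "norm q < 1" "q \<noteq> 0" and b: "norm b < 1"
    and e: "\<And>i j. int i + int j - 4 \<le> e i j"
  shows "(\<lambda>(i, j). q powi e i j / (qpoch b b (M i) * qpoch b b j)) summable_on UNIV"
proof -
  obtain K where K: "K \<ge> 1" "\<And>n. norm (1 / qpoch b b n) \<le> K"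
    using inverse_qpoch_bounded[OF b] by blast
  show ?thesis
  proof (rule summable_on_geometric_bound[of "norm q"])
  fix i j :: nat
  have "norm (q powi e i j) \<le> norm q powi (int i + int j - 4)"
    by (rule norm_powi_le[OF q e])
  also have "\<dots> = norm q ^ (i + j) / norm q ^ 4"
    using q by (simp add: power_int_diff power_int_add power_add)
  finally have "norm (q powi e i j) * (norm (1 / qpoch b b (M i)) * norm (1 / qpoch b b j)) \<le>
    norm q ^ (i + j) / norm q ^ 4 * (K * K)"
    using K by (intro mult_mono) auto
  then show "norm (case (i, j) of (i, j) \<Rightarrow> q powi e i j / (qpoch b b (M i) * qpoch b b j)) \<le>
    K * K / norm q ^ 4 * norm q ^ (i + j)"
    by (simp add: norm_mult norm_divide mult_ac)
  qed (use q in auto)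
qed

lemma exponent_ge:
  fixes i j :: int
  shows "i + j - 4 \<le> 2 * i ^ 2 - i * j + (j ^ 2 - j) div 2"
    and "i + j - 4 \<le> 4 * i ^ 2 - 2 * i * j + j ^ 2 - 2 * i"
proof -
  have "2 * ((j\<^sup>2 - j) div 2) = j\<^sup>2 - j"
    by (rule two_times_div_two) simp
  \<comment> \<open>Completing squares: 8 times the difference of the two sides is (2j - 2i - 3)^2 +
    12 i^2 - 20 i + 23, and 3 times the part in i is (6i - 5)^2 + 44.\<close>
  moreover have "0 \<le> (2 * j - 2 * i - 3)\<^sup>2" "0 \<le> (6 * i - 5)\<^sup>2"
    by simp_all
  ultimately show "i + j - 4 \<le> 2 * i ^ 2 - i * j + (j ^ 2 - j) div 2"
    by (simp add: power2_eq_square algebra_simps)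
  have "0 \<le> (2 * j - 2 * i - 1)\<^sup>2" "0 \<le> (3 * i - 2)\<^sup>2"
    by simp_all
  then show "i + j - 4 \<le> 4 * i ^ 2 - 2 * i * j + j ^ 2 - 2 * i"
    by (simp add: power2_eq_square algebra_simps)
qed

section \<open>Product evaluations\<close>

lemma choose_two_Suc: "(Suc i choose 2) = i + (i choose 2)"
  by (simp add: numeral_2_eq_2)

lemma choose_two_sum: "(i choose 2) + (Suc i choose 2) = i\<^sup>2"
  by (induction i) (auto simp: numeral_2_eq_2 power2_eq_square)

text \<open>The factor k = 0 gives the 2 of the right-hand sides; the rest is Euler's (-q;q)_inf =
  1/(q;q^2)_inf.\<close>

lemma qpoch_inf_neg_one:
  assumes "norm q < 1" "q \<noteq> 0"
  shows "qpoch_inf (- 1) q = 2 / qpoch_inf q (q\<^sup>2)"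
proof -
  have "qpoch_inf (- 1) q = 2 * qpoch_inf (- q) q"
    using qpoch_inf_split[OF assms(1), of "- 1" 1] by (simp add: qpoch_def)
  moreover have "qpoch_inf q q = qpoch_inf q (q\<^sup>2) * qpoch_inf (q\<^sup>2) (q\<^sup>2)"
    using qpoch_inf_dissect[OF assms(1), of 2 q] by (simp add: numeral_2_eq_2)
  moreover have "qpoch_inf q q * qpoch_inf (- q) q = qpoch_inf (q\<^sup>2) (q\<^sup>2)"
    by (rule qpoch_inf_minus[OF assms(1)])
  moreover have "norm (q\<^sup>2) < 1"
    by (rule norm_power_lt_1[OF assms(1) pos2])
  then have "qpoch_inf q (q\<^sup>2) \<noteq> 0" "qpoch_inf (q\<^sup>2) (q\<^sup>2) \<noteq> 0"
    using qpoch_inf_nonzero assms by blast+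
  ultimately show ?thesis
    by (auto simp: field_simps)
qed

lemma qpoch_inf_dissect_power:
  assumes "norm q < 1" "m > 0" "k > 0"
  shows "qpoch_inf (a * q ^ r) (q ^ m) = (\<Prod>s<k. qpoch_inf (a * q ^ (r + m * s)) (q ^ (m * k)))"
  using qpoch_inf_dissect[OF norm_power_lt_1[OF assms(1,2)] assms(3), of "a * q ^ r"]
  by (simp add: power_mult power_add mult.assoc)

text \<open>The even part of (q;q)_inf splits into five classes modulo 10, of which the theta
  product cancels three. One factor (q;q^2)_inf comes from (q;q)_inf, the other from
  (-1;q)_inf.\<close>

lemma product_mod_10:
  assumes "norm q < 1" "q \<noteq> 0"
  shows "qpoch_inf (q ^ 6) (q ^ 10) * qpoch_inf (q ^ 4) (q ^ 10) * qpoch_inf (q ^ 10) (q ^ 10) / qpoch_inf q q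
       * qpoch_inf (- 1) q = 2 / (qpoch_inf q (q\<^sup>2) ^ 2 * qpochs_inf [q\<^sup>2, q ^ 8] (q ^ 10))"
    and "qpoch_inf (q ^ 8) (q ^ 10) * qpoch_inf (q ^ 2) (q ^ 10) * qpoch_inf (q ^ 10) (q ^ 10) / qpoch_inf q q
       * qpoch_inf (- 1) q = 2 / (qpoch_inf q (q\<^sup>2) ^ 2 * qpochs_inf [q ^ 4, q ^ 6] (q ^ 10))"
proof -
  define x where "x r = qpoch_inf (q ^ r) (q ^ 10)" for r
  have nz: "x r \<noteq> 0" if "r > 0" for r
    unfolding x_def using that by (intro qpoch_inf_nonzero norm_power_lt_1 assms) auto
  have "qpoch_inf q q = qpoch_inf q (q\<^sup>2) * qpoch_inf (q\<^sup>2) (q\<^sup>2)"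
    using qpoch_inf_dissect[OF assms(1), of 2 q] by (simp add: numeral_2_eq_2)
  also have "qpoch_inf (q\<^sup>2) (q\<^sup>2) = x 2 * x 4 * x 6 * x 8 * x 10"
  proof -
    have "qpoch_inf (q\<^sup>2) (q\<^sup>2) = (\<Prod>s<5. x (2 + 2 * s))"
      using qpoch_inf_dissect_power[OF assms(1), of 2 5 1 2] by (simp add: x_def)
    then show ?thesis
      by (simp add: lessThan_nat_numeral mult_ac flip: numeral_2_eq_2)
  qed
  finally have *: "qpoch_inf q q = qpoch_inf q (q\<^sup>2) * (x 2 * x 4 * x 6 * x 8 * x 10)" .
  show "qpoch_inf (q ^ 6) (q ^ 10) * qpoch_inf (q ^ 4) (q ^ 10) * qpoch_inf (q ^ 10) (q ^ 10) / qpoch_inf q q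
       * qpoch_inf (- 1) q = 2 / (qpoch_inf q (q\<^sup>2) ^ 2 * qpochs_inf [q\<^sup>2, q ^ 8] (q ^ 10))"
    and "qpoch_inf (q ^ 8) (q ^ 10) * qpoch_inf (q ^ 2) (q ^ 10) * qpoch_inf (q ^ 10) (q ^ 10) / qpoch_inf q q
       * qpoch_inf (- 1) q = 2 / (qpoch_inf q (q\<^sup>2) ^ 2 * qpochs_inf [q ^ 4, q ^ 6] (q ^ 10))"
    unfolding * qpoch_inf_neg_one[OF assms] qpochs_inf_def
    using nz[of 2] nz[of 4] nz[of 6] nz[of 8] nz[of 10]
    by (simp_all add: power2_eq_square[of "qpoch_inf q (q\<^sup>2)"] flip: x_def)
qed

lemma product_mod_20:
  assumes q: "norm q < 1" "q \<noteq> 0"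
  defines "p \<equiv> - q"
  shows "qpoch_inf (p ^ 4) (p ^ 5) * qpoch_inf p (p ^ 5) * qpoch_inf (p ^ 5) (p ^ 5) /
      qpoch_inf (p\<^sup>2) (p\<^sup>2) * qpoch_inf (- q) (q\<^sup>2) =
      Jm 2 q ^ 2 * Jm 10 q * Jam 3 10 q * Jam 2 20 q * Jam 6 20 q
        / (Jm 1 q ^ 2 * Jm 20 q ^ 3 * Jam 8 20 q)"
    and "qpoch_inf (p ^ 3) (p ^ 5) * qpoch_inf (p ^ 2) (p ^ 5) * qpoch_inf (p ^ 5) (p ^ 5) /
      qpoch_inf (p\<^sup>2) (p\<^sup>2) * qpoch_inf (- q) (q\<^sup>2) =
      Jm 2 q ^ 2 * Jm 10 q * Jam 1 10 q * Jam 2 20 q * Jam 6 20 q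
        / (Jm 1 q ^ 2 * Jm 20 q ^ 3 * Jam 4 20 q)"
proof -
  \<comment> \<open>Every product is rewritten in these functions of r modulo 20, after which both
    claims are identities of monomials.\<close>
  define x where "x r = qpoch_inf (q ^ r) (q ^ 20)" for r
  have x_nz: "x r \<noteq> 0" if "r > 0" for r
    unfolding x_def using that by (intro qpoch_inf_nonzero norm_power_lt_1 q) auto
  note nz = x_nz[of 1] x_nz[of 2] x_nz[of 3] x_nz[of 4] x_nz[of 5] x_nz[of 6] x_nz[of 7] x_nz[of 8]
    x_nz[of 9] x_nz[of 10] x_nz[of 11] x_nz[of 12] x_nz[of 13] x_nz[of 14] x_nz[of 15] x_nz[of 16]
    x_nz[of 17] x_nz[of 18] x_nz[of 19] x_nz[of 20]
  have split: "qpoch_inf (q ^ r) (q ^ m) = (\<Prod>s<k. x (r + m * s))" if "m * k = 20" for r m k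
    using qpoch_inf_dissect_power[OF q(1), of m k 1 r] that
    by (cases "m = 0 \<or> k = 0") (auto simp: x_def)
  have ten: "qpoch_inf (q ^ r) (q ^ 10) = x r * x (r + 10)" for r
    using split[of 10 2 r] by (simp add: numeral_2_eq_2)
  have neg: "qpoch_inf (- (q ^ r)) (q ^ 10) = x (2 * r) / (x r * x (r + 10))" if "r > 0" for r
  proof -
    have "qpoch_inf (q ^ r) (q ^ 10) * qpoch_inf (- (q ^ r)) (q ^ 10) = x (2 * r)"
      using qpoch_inf_minus[of "q ^ 10" "q ^ r"] norm_power_lt_1[OF q(1), of 10]
      by (simp add: x_def power_mult[symmetric] mult.commute)
    then show ?thesis
      using that x_nz[of r] x_nz[of "r + 10"] by (simp add: ten field_simps)
  qed
  have J1: "Jm 1 q = x 1 * x 2 * x 3 * x 4 * x 5 * x 6 * x 7 * x 8 * x 9 * x 10 * x 11 * x 12 * x 13 * x 14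
      * x 15 * x 16 * x 17 * x 18 * x 19 * x 20"
    using split[of 1 20 1] by (simp add: Jm_def lessThan_nat_numeral mult_ac flip: numeral_2_eq_2)
  have J2: "qpoch_inf (q\<^sup>2) (q\<^sup>2) = x 2 * x 4 * x 6 * x 8 * x 10 * x 12 * x 14 * x 16 * x 18 * x 20"
    using split[of 2 10 2] by (simp add: lessThan_nat_numeral mult_ac flip: numeral_2_eq_2)
  have odd: "qpoch_inf (- q) (q\<^sup>2) = x 2 / (x 1 * x 11) * (x 6 / (x 3 * x 13)) * (x 10 / (x 5 * x 15)) *
      (x 14 / (x 7 * x 17)) * (x 18 / (x 9 * x 19))"
  proof -
    have "qpoch_inf (- q) (q\<^sup>2) = (\<Prod>s<5. qpoch_inf (- (q ^ (1 + 2 * s))) (q ^ 10))"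
      using qpoch_inf_dissect_power[OF q(1), of 2 5 "- 1" 1] by simp
    also have "\<dots> = (\<Prod>s<5. x (2 * (1 + 2 * s)) / (x (1 + 2 * s) * x (1 + 2 * s + 10)))"
      by (simp only: neg zero_less_Suc plus_1_eq_Suc)
    finally show ?thesis
      by (simp add: lessThan_nat_numeral mult_ac flip: numeral_2_eq_2)
  qed
  \<comment> \<open>Base p^5 is split into two classes of base p^10 = q^10, so that the sign of p
    survives only in the first arguments, at odd exponents.\<close>
  have five: "qpoch_inf (p ^ r) (p ^ 5) = qpoch_inf (p ^ r) (q ^ 10) * qpoch_inf (p ^ (r + 5)) (q ^ 10)" for r
  proof -
    have "p ^ 10 = q ^ 10" "norm p < 1"
      using q by (simp_all add: p_def uminus_power_if)
    then show ?thesis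
      using qpoch_inf_dissect[of "p ^ 5" 2 "p ^ r"] norm_power_lt_1[of p 5]
      by (simp add: numeral_2_eq_2 power_mult[symmetric] power_add[symmetric])
  qed
  have theta: "qpoch_inf p (p ^ 5) = x 2 / (x 1 * x 11) * (x 6 * x 16)"
      "qpoch_inf (p ^ 2) (p ^ 5) = x 2 * x 12 * (x 14 / (x 7 * x 17))"
      "qpoch_inf (p ^ 3) (p ^ 5) = x 6 / (x 3 * x 13) * (x 8 * x 18)"
      "qpoch_inf (p ^ 4) (p ^ 5) = x 4 * x 14 * (x 18 / (x 9 * x 19))"
      "qpoch_inf (p ^ 5) (p ^ 5) = x 10 / (x 5 * x 15) * (x 10 * x 20)"
    using five[of 1] five[of 2] five[of 3] five[of 4] five[of 5] neg[of 1] neg[of 3] neg[of 5] neg[of 7] neg[of 9]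
    by (simp_all add: p_def ten)
  have J: "Jm 2 q = qpoch_inf (q\<^sup>2) (q\<^sup>2)" "Jm 10 q = x 10 * x 20" "Jm 20 q = x 20"
      "Jam 1 10 q = x 1 * x 11 * (x 9 * x 19) * (x 10 * x 20)"
      "Jam 3 10 q = x 3 * x 13 * (x 7 * x 17) * (x 10 * x 20)"
      "Jam 2 20 q = x 2 * x 18 * x 20" "Jam 6 20 q = x 6 * x 14 * x 20"
      "Jam 8 20 q = x 8 * x 12 * x 20" "Jam 4 20 q = x 4 * x 16 * x 20"
    using ten[of 1] by (simp_all add: Jm_def Jam_def qpochs_inf_def ten flip: x_def)
  have p2: "p\<^sup>2 = q\<^sup>2" by (simp add: p_def)
  show "qpoch_inf (p ^ 4) (p ^ 5) * qpoch_inf p (p ^ 5) * qpoch_inf (p ^ 5) (p ^ 5) /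
      qpoch_inf (p\<^sup>2) (p\<^sup>2) * qpoch_inf (- q) (q\<^sup>2) =
      Jm 2 q ^ 2 * Jm 10 q * Jam 3 10 q * Jam 2 20 q * Jam 6 20 q
        / (Jm 1 q ^ 2 * Jm 20 q ^ 3 * Jam 8 20 q)"
    unfolding theta J J1 unfolding p2 J2 odd using nz
    by (simp add: divide_simps power2_eq_square power3_eq_cube)
  show "qpoch_inf (p ^ 3) (p ^ 5) * qpoch_inf (p ^ 2) (p ^ 5) * qpoch_inf (p ^ 5) (p ^ 5) /
      qpoch_inf (p\<^sup>2) (p\<^sup>2) * qpoch_inf (- q) (q\<^sup>2) =
      Jm 2 q ^ 2 * Jm 10 q * Jam 1 10 q * Jam 2 20 q * Jam 6 20 q
        / (Jm 1 q ^ 2 * Jm 20 q ^ 3 * Jam 4 20 q)"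
    unfolding theta J J1 unfolding p2 J2 odd using nz
    by (simp add: divide_simps power2_eq_square power3_eq_cube)
qed

section \<open>The double sums for nonzero q\<close>

text \<open>Euler summation with b = q and x = 1 produces (-1;q)_inf. The assumption
  \<open>closed\<close> matches the remaining summand with the Bailey side.\<close>

lemma has_sum_base_q:
  assumes q: "norm q < 1" "q \<noteq> 0" and E: "E \<le> 1"
    and closed: "\<And>i. q ^ (i\<^sup>2 + E * i) * vsum q (2 * i + E) (int i + int E) c =
      q ^ (2 * i\<^sup>2 + e * i) / q ^ (Suc i choose 2) * qpoch (- q) q i / qpoch q q (2 * i + E)"
  shows "((\<lambda>(i, j). q powi (2 * int i ^ 2 - int i * int j + (int j ^ 2 - int j) div 2 + int e * int i)
      / (qpoch q q (2 * i + E) * qpoch q q j))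
    has_sum qpoch_inf (q powi (5 + c + 2 * int E)) (q ^ 10) * qpoch_inf (q powi (5 - c - 2 * int E)) (q ^ 10) *
      qpoch_inf (q ^ 10) (q ^ 10) / qpoch_inf q q * qpoch_inf (- 1) q) UNIV"
proof (rule has_sum_double[OF q])
  show "(1 :: complex) \<noteq> 0" by simp
  fix i j
  have "2 * int i ^ 2 - int i * int j + (int j ^ 2 - int j) div 2 + int e * int i =
    int (2 * i\<^sup>2 + e * i) + (int (j choose 2) + - int (i * j))"
    by (simp add: int_choose_two)
  then have "q powi (2 * int i ^ 2 - int i * int j + (int j ^ 2 - int j) div 2 + int e * int i) =
    q ^ (2 * i\<^sup>2 + e * i) * (q ^ (j choose 2) * q powi - int (i * j))"
    using q(2) by (simp only: powi_add power_int_of_nat simp_thms)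
  moreover have "q powi - int (i * j) = (1 / q ^ i) ^ j"
    by (simp only: power_int_minus power_int_of_nat power_mult power_one_over inverse_eq_divide)
  ultimately show "(case (i, j) of (i, j) \<Rightarrow>
      q powi (2 * int i ^ 2 - int i * int j + (int j ^ 2 - int j) div 2 + int e * int i)
      / (qpoch q q (2 * i + E) * qpoch q q j)) =
    q ^ (2 * i\<^sup>2 + e * i) / qpoch q q (2 * i + E) * (q ^ (j choose 2) / qpoch q q j * (1 / q ^ i) ^ j)"
    by simp
next
  show "(\<lambda>(i, j). q powi (2 * int i ^ 2 - int i * int j + (int j ^ 2 - int j) div 2 + int e * int i)
      / (qpoch q q (2 * i + E) * qpoch q q j)) summable_on UNIV"
    by (intro summable_on_double q order.trans[OF exponent_ge(1)]) simp
next
  fix i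
  show "q ^ (2 * i\<^sup>2 + e * i) / qpoch q q (2 * i + E) *
      (1 ^ i / q ^ (Suc i choose 2) * qpoch (- (q / 1)) q i) =
    q ^ (i\<^sup>2 + E * i) * vsum q (2 * i + E) (int i + int E) c"
    unfolding closed by simp
qed (rule has_sum_vsum[OF q E])

text \<open>Since q^(j^2) = (q^2)^(j(j-1)/2) q^j, Euler summation applies with b = q^2 and x = q. It
  leaves (-q;q^2)_i, which is (p;p^2)_i for p = -q; hence the theta series in -q.\<close>

lemma has_sum_base_q2:
  fixes e :: nat
  assumes q: "norm q < 1" "q \<noteq> 0" and c: "odd c"
    and e: "\<And>i j. int i + int j - 4 \<le> 4 * int i ^ 2 - 2 * int i * int j + int j ^ 2 - int e * int i"
    and closed: "\<And>i. (q\<^sup>2) ^ i\<^sup>2 * usum (- q) (2 * i) (int i) c =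
      q ^ (3 * i\<^sup>2) / q ^ (e * i) * qpoch (- q) (q\<^sup>2) i / qpoch (q\<^sup>2) (q\<^sup>2) (2 * i)"
  shows "((\<lambda>(i, j). q powi (4 * int i ^ 2 - 2 * int i * int j + int j ^ 2 - int e * int i)
      / (qpoch (q\<^sup>2) (q\<^sup>2) (2 * i) * qpoch (q\<^sup>2) (q\<^sup>2) j))
    has_sum qpoch_inf ((- q) powi ((5 + c) div 2)) ((- q) ^ 5) * qpoch_inf ((- q) powi ((5 - c) div 2)) ((- q) ^ 5) *
      qpoch_inf ((- q) ^ 5) ((- q) ^ 5) / qpoch_inf ((- q)\<^sup>2) ((- q)\<^sup>2) * qpoch_inf (- q) (q\<^sup>2)) UNIV"
proof (rule has_sum_double)
  show q2: "norm (q\<^sup>2) < 1"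
    by (rule norm_power_lt_1[OF q(1) pos2])
  show "q\<^sup>2 \<noteq> 0" "q \<noteq> 0" using q by auto
  fix i j
  have "(q\<^sup>2) ^ (j choose 2) * (q / (q\<^sup>2) ^ i) ^ j = q powi (int (2 * (j choose 2) + j) + - int (2 * i * j))"
    unfolding powi_add[OF q(2)] power_int_minus power_int_of_nat
    by (simp add: power_divide power_add power_mult power_mult_distrib power_inverse divide_inverse)
  moreover have "q powi int (4 * i\<^sup>2) * q powi - int (e * i) = q ^ (4 * i\<^sup>2) / q ^ (e * i)"
    by (simp only: power_int_minus power_int_of_nat divide_inverse)
  moreover have "int (2 * (j choose 2)) = int j ^ 2 - int j"
    by (simp add: int_choose_two)
  then have "4 * int i ^ 2 - 2 * int i * int j + int j ^ 2 - int e * int i =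
    (int (4 * i\<^sup>2) + - int (e * i)) + (int (2 * (j choose 2) + j) + - int (2 * i * j))"
    by simp
  then have "q powi (4 * int i ^ 2 - 2 * int i * int j + int j ^ 2 - int e * int i) =
    (q powi int (4 * i\<^sup>2) * q powi - int (e * i)) * q powi (int (2 * (j choose 2) + j) + - int (2 * i * j))"
    by (simp only: powi_add[OF q(2), of "int (4 * i\<^sup>2) + - int (e * i)"] powi_add[OF q(2), of "int (4 * i\<^sup>2)"])
  ultimately show "(case (i, j) of (i, j) \<Rightarrow>
      q powi (4 * int i ^ 2 - 2 * int i * int j + int j ^ 2 - int e * int i)
      / (qpoch (q\<^sup>2) (q\<^sup>2) (2 * i) * qpoch (q\<^sup>2) (q\<^sup>2) j)) =
    q ^ (4 * i\<^sup>2) / q ^ (e * i) / qpoch (q\<^sup>2) (q\<^sup>2) (2 * i) *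
      ((q\<^sup>2) ^ (j choose 2) / qpoch (q\<^sup>2) (q\<^sup>2) j * (q / (q\<^sup>2) ^ i) ^ j)"
    by (simp add: mult_ac)
next
  show "(\<lambda>(i, j). q powi (4 * int i ^ 2 - 2 * int i * int j + int j ^ 2 - int e * int i)
      / (qpoch (q\<^sup>2) (q\<^sup>2) (2 * i) * qpoch (q\<^sup>2) (q\<^sup>2) j)) summable_on UNIV"
    by (intro summable_on_double q e norm_power_lt_1) simp
next
  fix i
  \<comment> \<open>The shift formula divides by q^(i(i+1)), which lowers 4 i^2 + i to 3
    i^2.\<close>
  have "i + 4 * i\<^sup>2 = 3 * i\<^sup>2 + 2 * (Suc i choose 2)"
    using choose_two_sum[of i] choose_two_Suc[of i] by linarith
  then have "q ^ i * q ^ (4 * i\<^sup>2) = q ^ (3 * i\<^sup>2) * (q\<^sup>2) ^ (Suc i choose 2)"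
    by (simp only: power_add[symmetric] power_mult[symmetric])
  then have *: "q ^ (3 * i\<^sup>2) = q ^ (4 * i\<^sup>2) * (q ^ i / (q\<^sup>2) ^ (Suc i choose 2))"
    using q by (simp add: nonzero_eq_divide_eq mult.commute[of "q ^ i"])
  have "q\<^sup>2 / q = q"
    by (simp add: power2_eq_square)
  then show "q ^ (4 * i\<^sup>2) / q ^ (e * i) / qpoch (q\<^sup>2) (q\<^sup>2) (2 * i) *
      (q ^ i / (q\<^sup>2) ^ (Suc i choose 2) * qpoch (- (q\<^sup>2 / q)) (q\<^sup>2) i) =
    ((- q)\<^sup>2) ^ i\<^sup>2 * usum (- q) (2 * i) (int i) c"
    unfolding power2_minus closed * by (simp add: mult_ac)
next
  show "((\<lambda>n. ((- q)\<^sup>2) ^ n\<^sup>2 * usum (- q) (2 * n) (int n) c) has_sum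
    qpoch_inf ((- q) powi ((5 + c) div 2)) ((- q) ^ 5) * qpoch_inf ((- q) powi ((5 - c) div 2)) ((- q) ^ 5) *
      qpoch_inf ((- q) ^ 5) ((- q) ^ 5) / qpoch_inf ((- q)\<^sup>2) ((- q)\<^sup>2)) UNIV"
    using q by (intro has_sum_usum c) auto
qed

section \<open>The degenerate case q = 0\<close>

lemma has_sum_at_0:
  fixes e :: "nat \<Rightarrow> nat \<Rightarrow> int"
  assumes "finite B" "\<And>i j. e i j = 0 \<longleftrightarrow> (i, j) \<in> B"
  shows "((\<lambda>(i, j). (0 :: complex) powi e i j / (qpoch 0 0 (M i) * qpoch 0 0 j)) has_sum of_nat (card B)) UNIV"
proof (rule has_sum_finite_neutralI[OF assms(1)])
  \<comment> \<open>All denominators are 1, and 0 powi e is 1 for e = 0 and 0 otherwise, so the sum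
    counts the zeros of the exponent.\<close>
  have "qpoch 0 0 n = 1" for n
    by (simp add: qpoch_def)
  then have "(case x of (i, j) \<Rightarrow> (0 :: complex) powi e i j / (qpoch 0 0 (M i) * qpoch 0 0 j)) =
    (if x \<in> B then 1 else 0)" for x
    using assms(2) by (cases x) (auto simp: power_int_0_left_if)
  then show "of_nat (card B) = (\<Sum>x\<in>B. case x of (i, j) \<Rightarrow> (0 :: complex) powi e i j / (qpoch 0 0 (M i) * qpoch 0 0 j))"
    "\<And>x. x \<in> UNIV - B \<Longrightarrow> (case x of (i, j) \<Rightarrow> (0 :: complex) powi e i j / (qpoch 0 0 (M i) * qpoch 0 0 j)) = 0"
    by simp_all
qed auto

lemma exponent_eq_0:
  "2 * int i ^ 2 - int i * int j + (int j ^ 2 - int j) div 2 + int e * int i = 0 \<longleftrightarrow>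
    (i, j) \<in> {(0, 0), (0, 1)}"
  "0 \<le> e \<Longrightarrow> e \<le> 2 \<Longrightarrow> 4 * int i ^ 2 - 2 * int i * int j + int j ^ 2 - e * int i = 0 \<longleftrightarrow>
    (i, j) \<in> {(0, 0)}"
proof -
  let ?x = "2 * int i ^ 2 - int i * int j + (int j ^ 2 - int j) div 2"
  have x: "2 * ?x = 4 * int i ^ 2 - 2 * int i * int j + int j ^ 2 - int j"
    using two_times_div_two[of "int j ^ 2 - int j"] by (simp add: algebra_simps)
  show "?x + int e * int i = 0 \<longleftrightarrow> (i, j) \<in> {(0, 0), (0, 1)}"
  proof (cases "i = 0")
    case True
    have "?x = 0 \<longleftrightarrow> 2 * ?x = 0"
      by (simp only: mult_eq_0_iff) simp
    also have "\<dots> \<longleftrightarrow> int j ^ 2 = int j"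
      unfolding x using True by simp
    also have "\<dots> \<longleftrightarrow> j = 0 \<or> j = 1"
      by (auto simp: power2_eq_square)
    finally show ?thesis using True by simp
  next
    case False
    \<comment> \<open>For i \<ge> 1, eight times the exponent without its e-term equals (2j - 2i -
      1)^2 + (i - 1)(12i + 8) + 7.\<close>
    then have "0 \<le> (int i - 1) * (12 * int i + 8)" by simp
    moreover have "0 \<le> (2 * int j - 2 * int i - 1)\<^sup>2" by simp
    ultimately have "0 < 4 * (2 * ?x)"
      unfolding x by (simp add: power2_eq_square algebra_simps)
    then have "0 < ?x" by (simp only: zero_less_mult_iff) simp
    then have "0 < ?x + int e * int i"
      by (simp add: add_pos_nonneg)
    then show ?thesis using False by auto
  qed
  assume "0 \<le> e" "e \<le> 2"
  show "4 * int i ^ 2 - 2 * int i * int j + int j ^ 2 - e * int i = 0 \<longleftrightarrow> (i, j) \<in> {(0, 0)}"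
  proof (cases "i = 0")
    case False
    \<comment> \<open>With e = 2 the exponent is (j - i)^2 + (i - 1)(3i + 1) + 1; a smaller e only
      increases it.\<close>
    then have "0 \<le> (int i - 1) * (3 * int i + 1)" by simp
    moreover have "0 \<le> (int j - int i)\<^sup>2" by simp
    moreover have "e * int i \<le> 2 * int i"
      using \<open>e \<le> 2\<close> by (intro mult_right_mono) auto
    ultimately have "0 < 4 * int i ^ 2 - 2 * int i * int j + int j ^ 2 - e * int i"
      by (simp add: power2_eq_square algebra_simps)
    then show ?thesis using False by auto
  qed auto
qed

theorem theorem5p4:
  fixes q :: complex
  assumes "norm q < 1"
  shows "(((\<lambda>(i::nat, j::nat).
            q powi (2 * int i ^ 2 - int i * int j + (int j ^ 2 - int j) div 2)
              / (qpoch q q (2 * i) * qpoch q q j))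
          has_sum 2 / (qpoch_inf q (q ^ 2) ^ 2 * qpochs_inf [q ^ 2, q ^ 8] (q ^ 10))) UNIV)
    \<and> (((\<lambda>(i::nat, j::nat).
            q powi (2 * int i ^ 2 - int i * int j + (int j ^ 2 - int j) div 2 + int i)
              / (qpoch q q (2 * i + 1) * qpoch q q j))
          has_sum 2 / (qpoch_inf q (q ^ 2) ^ 2 * qpochs_inf [q ^ 2, q ^ 8] (q ^ 10))) UNIV)
    \<and> (((\<lambda>(i::nat, j::nat).
            q powi (2 * int i ^ 2 - int i * int j + (int j ^ 2 - int j) div 2 + 2 * int i)
              / (qpoch q q (2 * i + 1) * qpoch q q j))
          has_sum 2 / (qpoch_inf q (q ^ 2) ^ 2 * qpochs_inf [q ^ 4, q ^ 6] (q ^ 10))) UNIV)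
    \<and> (((\<lambda>(i::nat, j::nat).
            q powi (4 * int i ^ 2 - 2 * int i * int j + int j ^ 2 - 2 * int i)
              / (qpoch (q ^ 2) (q ^ 2) (2 * i) * qpoch (q ^ 2) (q ^ 2) j))
          has_sum (Jm 2 q ^ 2 * Jm 10 q * Jam 3 10 q * Jam 2 20 q * Jam 6 20 q
                    / (Jm 1 q ^ 2 * Jm 20 q ^ 3 * Jam 8 20 q))) UNIV)
    \<and> (((\<lambda>(i::nat, j::nat).
            q powi (4 * int i ^ 2 - 2 * int i * int j + int j ^ 2)
              / (qpoch (q ^ 2) (q ^ 2) (2 * i) * qpoch (q ^ 2) (q ^ 2) j))
          has_sum (Jm 2 q ^ 2 * Jm 10 q * Jam 1 10 q * Jam 2 20 q * Jam 6 20 q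
                    / (Jm 1 q ^ 2 * Jm 20 q ^ 3 * Jam 4 20 q))) UNIV)"
proof (cases "q = 0")
  case True
  \<comment> \<open>All products become 1, so the right-hand sides are 2, 2, 2, 1, 1, matching the
    numbers of zeros of the exponents.\<close>
  have prod: "qpoch_inf 0 0 = 1"
    by (simp add: qpoch_inf_def)
  show ?thesis
    unfolding True
    using has_sum_at_0[OF _ exponent_eq_0(1)[of _ _ 0], of "\<lambda>i. 2 * i"]
      has_sum_at_0[OF _ exponent_eq_0(1)[of _ _ 1], of "\<lambda>i. 2 * i + 1"]
      has_sum_at_0[OF _ exponent_eq_0(1)[of _ _ 2], of "\<lambda>i. 2 * i + 1"]
      has_sum_at_0[OF _ exponent_eq_0(2)[of 2], of "\<lambda>i. 2 * i"]
      has_sum_at_0[OF _ exponent_eq_0(2)[of 0], of "\<lambda>i. 2 * i"]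
    by (simp add: prod Jm_def Jam_def qpochs_inf_def)
next
  case False
  note q = assms False
  have split_square: "q ^ (2 * i\<^sup>2) = q ^ i\<^sup>2 * (q ^ (i choose 2) * q ^ (Suc i choose 2))" for i
    by (simp add: mult_2 power_add flip: choose_two_sum)
  have split_square': "q ^ i\<^sup>2 * q ^ i = q ^ (Suc i choose 2) * q ^ (Suc i choose 2)" for i
  proof -
    have "i\<^sup>2 + i = (Suc i choose 2) + (Suc i choose 2)"
      using choose_two_sum[of i] choose_two_Suc[of i] by linarith
    then show ?thesis by (metis power_add)
  qed
  \<comment> \<open>The first three identities use (E, c, e) = (0, 1, 0), (1, -1, 1) and (1, 1, 2).
    The theta exponents depend only on c + 2E, which is 1, 1 and 3; this is why the first two values
    agree.\<close>
  have even: "q ^ (i\<^sup>2 + 0 * i) * vsum q (2 * i + 0) (int i + int 0) 1 =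
      q ^ (2 * i\<^sup>2 + 0 * i) / q ^ (Suc i choose 2) * qpoch (- q) q i / qpoch q q (2 * i + 0)" for i
    using q by (simp add: vsum_closed_even split_square)
  have odd1: "q ^ (i\<^sup>2 + 1 * i) * vsum q (2 * i + 1) (int i + int 1) (- 1) =
      q ^ (2 * i\<^sup>2 + 1 * i) / q ^ (Suc i choose 2) * qpoch (- q) q i / qpoch q q (2 * i + 1)" for i
    using q vsum_closed_odd(2)[OF q, of i] by (simp add: split_square power_add)
  have odd2: "q ^ (i\<^sup>2 + 1 * i) * vsum q (2 * i + 1) (int i + int 1) 1 =
      q ^ (2 * i\<^sup>2 + 2 * i) / q ^ (Suc i choose 2) * qpoch (- q) q i / qpoch q q (2 * i + 1)" for i
  proof -
    have "q ^ (2 * i\<^sup>2 + 2 * i) = (q ^ i\<^sup>2 * q ^ i) * (q ^ i\<^sup>2 * q ^ i)"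
      by (simp add: mult_2 power_add)
    then have "q ^ (2 * i\<^sup>2 + 2 * i) / q ^ (Suc i choose 2) = q ^ (i\<^sup>2 + 1 * i) * q ^ (Suc i choose 2)"
      using q by (simp add: split_square' power_add)
    then show ?thesis
      using vsum_closed_odd(1)[OF q, of i] by simp
  qed
  have p: "norm (- q) < 1" "- q \<noteq> 0"
    using q by auto
  have cube: "(q\<^sup>2) ^ i\<^sup>2 * ((- 1) ^ i * (- q) ^ i\<^sup>2) = q ^ (3 * i\<^sup>2)" for i
  proof -
    \<comment> \<open>The signs cancel because i and i^2 have the same parity.\<close>
    have "(- 1) ^ i * (- q) ^ i\<^sup>2 = q ^ i\<^sup>2"
      by (cases "even i") simp_all
    moreover have "(q\<^sup>2) ^ i\<^sup>2 * q ^ i\<^sup>2 = q ^ (3 * i\<^sup>2)"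
      by (simp flip: power_mult power_add)
    ultimately show ?thesis by simp
  qed
  \<comment> \<open>The choice c = 1 serves the fifth identity, with theta exponents 3 and 2; c = 3
    serves the fourth, with exponents 4 and 1.\<close>
  have base1: "(q\<^sup>2) ^ i\<^sup>2 * usum (- q) (2 * i) (int i) 1 =
      q ^ (3 * i\<^sup>2) / q ^ (0 * i) * qpoch (- q) (q\<^sup>2) i / qpoch (q\<^sup>2) (q\<^sup>2) (2 * i)" for i
    using usum_closed[OF p, of i] by (simp flip: cube)
  have base3: "(q\<^sup>2) ^ i\<^sup>2 * usum (- q) (2 * i) (int i) 3 =
      q ^ (3 * i\<^sup>2) / q ^ (2 * i) * qpoch (- q) (q\<^sup>2) i / qpoch (q\<^sup>2) (q\<^sup>2) (2 * i)" for i
  proof -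
    have "usum (- q) (2 * i) (int i) 3 = usum (- q) (2 * i) (int i) 1 / q ^ (2 * i)"
      using usum_closed'[OF p, of i] q by (simp add: field_simps)
    then show ?thesis
      using base1[of i] by simp
  qed
  have exp0: "int i + int j - 4 \<le> 4 * int i ^ 2 - 2 * int i * int j + int j ^ 2 - int 0 * int i" for i j
    using exponent_ge(2)[of "int i" "int j"] by simp
  have exp2: "int i + int j - 4 \<le> 4 * int i ^ 2 - 2 * int i * int j + int j ^ 2 - int 2 * int i" for i j
    using exponent_ge(2)[of "int i" "int j"] by simp
  show ?thesis
    unfolding product_mod_10[OF q, symmetric] product_mod_20[OF q, symmetric]
    using has_sum_base_q[OF q _ even] has_sum_base_q[OF q _ odd1] has_sum_base_q[OF q _ odd2]
      has_sum_base_q2[OF q _ exp2 base3] has_sum_base_q2[OF q _ exp0 base1]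
    by simp
qed

end
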